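(* Let $p>2$, $g(u)=|u|^{p-2}u$, and assume $(a_* )$ and $(a_+)$. Let $\lambda_0>0$ and, for every $\lambda\ge\lambda_0$, let $u_\lambda$ be a solution of $$-\operatorname{div}\left(\frac{\nabla u}{\sqrt{1-|\nabla u|^2}}\right)=\lambda a(x)|u|^{p-2}u\ \text{ in }\Omega,\qquad \frac{\nabla u}{\sqrt{1-|\nabla u|^2}}\cdot\mathbf n=0\ \text{ on }\partial\Omega$$ with $I_\lambda(u_\lambda)=\inf_{C(\overline\Omega)}I_\lambda$. Let $u_\infty\ge0$ be the uniform limit on $\overline\Omega$ of $u_{\lambda_n}$ for some sequence $\lambda_n\to+\infty$ (so that $u_\infty\in K_a$ is a maximizer of $\mathcal J$ over $K_a$). Then $$\mathcal J(u_\infty)=M>0,\qquad M:=\max_{v\in K_a}\mathcal J(v),$$ and there exists $\mu\ge0$ such that for every connected open set $U\subset\Omega$ satisfying $$\|\nabla u_\infty\|_{L^\infty(U)}<1\qquad\text{and}\qquad a(x)\ne0\ \text{ for a.e. }x\in U,$$ one has either $$u_\infty\equiv0\ \text{ in }U,\qquad\text{or}\qquad u_\infty\equiv\frac{p-1}{p}\mu\ \text{ in }U,$$ with $\mu$ independent of $U$. Moreover, if $u_\infty\not\equiv0$ on at least one such set $U$, then $\mu>0$.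
   Context: $\Omega\subset\mathbb R^N$ is a bounded convex domain, $N\ge2$, with $\partial\Omega\in C^2$, and $\mathbf n$ is the exterior normal vector; $a:\Omega\to\mathbb R$. Hypotheses: $(a_* )$: $a\in L^\infty(\Omega)$ and $\int_\Omega a(x)\,dx<0$; $(a_+)$: the set $\{x\in\Omega:a(x)>0\}$ has nonempty interior. Solution: $u\in W^{1,\infty}(\Omega)$ with $\|\nabla u\|_{L^\infty(\Omega)}<1$ and $\int_\Omega\frac{\nabla u\cdot\nabla\phi}{\sqrt{1-|\nabla u|^2}}\,dx=\lambda\int_\Omega a(x)|u|^{p-2}u\,\phi\,dx$ for every $\phi\in C^1(\overline\Omega)$. $K:=\{u\in W^{1,\infty}(\Omega):\|\nabla u\|_{L^\infty(\Omega)}\le1\}\subset C(\overline\Omega)$, $K_a:=\{u\in K:\int_\Omega a(x)|u|^{p-2}u\,dx=0\}$, and $\mathcal J(u):=\int_\Omega a(x)|u|^p\,dx$. The functional $I_\lambda:C(\overline\Omega)\to(-\infty,+\infty]$ is $I_\lambda=\Psi+\Phi_\lambda$, where $\Psi(u)=\int_\Omega(1-\sqrt{1-|\nabla u|^2})\,dx$ if $u\in K$, $\Psi(u)=+\infty$ if $u\in C(\overline\Omega)\setminus K$, and $\Phi_\lambda(u)=-\frac{\lambda}{p}\int_\Omega a(x)|u|^p\,dx$. *)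

theory Defs
  imports "HOL-Analysis.Analysis" "HOL-Probability.Essential_Supremum"
begin

definition C2_function :: "('a::euclidean_space \<Rightarrow> real) \<Rightarrow> bool" where
  "C2_function \<gamma> \<longleftrightarrow> (\<exists>g (H :: 'a \<Rightarrow> 'a \<Rightarrow>\<^sub>L 'a).
     (\<forall>x. GDERIV \<gamma> x :> g x) \<and>
     (\<forall>x. (g has_derivative blinfun_apply (H x)) (at x)) \<and>
     continuous_on UNIV H)"

text \<open>The unit vector e is the last axis after a rotation, and gamma only enters through its values
  on the hyperplane orthogonal to e: locally the set is the open epigraph of a C^2 function of
  the remaining N - 1 orthonormal coordinates.\<close>

definition C2_boundary :: "'a::euclidean_space set \<Rightarrow> bool" where
  "C2_boundary \<Omega> \<longleftrightarrow> (\<forall>z\<in>frontier \<Omega>. \<exists>r>0. \<exists>e \<gamma>. norm e = 1 \<and> C2_function \<gamma> \<and>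
     \<Omega> \<inter> ball z r = {x \<in> ball z r. \<gamma> (x - (x \<bullet> e) *\<^sub>R e) < x \<bullet> e})"

definition Linf_norm :: "'a::euclidean_space set \<Rightarrow> ('a \<Rightarrow> 'b::euclidean_space) \<Rightarrow> ereal" where
  "Linf_norm S f = esssup (lebesgue_on S) (\<lambda>x. ereal (norm (f x)))"

definition Linf :: "'a::euclidean_space set \<Rightarrow> ('a \<Rightarrow> 'b::euclidean_space) set" where
  "Linf S = {f. f \<in> borel_measurable (lebesgue_on S) \<and> Linf_norm S f < \<infinity>}"

definition C1c_test :: "'a::euclidean_space set \<Rightarrow> ('a \<Rightarrow> real) \<Rightarrow> ('a \<Rightarrow> 'a) \<Rightarrow> bool" where
  "C1c_test \<Omega> \<phi> g \<longleftrightarrow> (\<forall>x. GDERIV \<phi> x :> g x) \<and> continuous_on UNIV g \<and>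
     (\<exists>C. compact C \<and> C \<subseteq> \<Omega> \<and> (\<forall>x. x \<notin> C \<longrightarrow> \<phi> x = 0))"

text \<open>Testing against compactly supported C^1 functions (as in Gilbarg and Trudinger) gives the
  same weak gradient as testing against smooth ones.\<close>

definition has_weak_gradient ::
  "'a::euclidean_space set \<Rightarrow> ('a \<Rightarrow> real) \<Rightarrow> ('a \<Rightarrow> 'a) \<Rightarrow> bool" where
  "has_weak_gradient \<Omega> u G \<longleftrightarrow>
     (\<forall>C. compact C \<and> C \<subseteq> \<Omega> \<longrightarrow> u absolutely_integrable_on C \<and> G absolutely_integrable_on C) \<and>
     (\<forall>\<phi> g. C1c_test \<Omega> \<phi> g \<longrightarrow>
        (LINT x|lebesgue_on \<Omega>. u x *\<^sub>R g x) = - (LINT x|lebesgue_on \<Omega>. \<phi> x *\<^sub>R G x))"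

text \<open>A weak gradient is unique only up to null sets; wgrad fixes an arbitrary representative and
  is meaningful only if a weak gradient exists.\<close>

definition wgrad :: "'a::euclidean_space set \<Rightarrow> ('a \<Rightarrow> real) \<Rightarrow> 'a \<Rightarrow> 'a" where
  "wgrad \<Omega> u = (SOME G. has_weak_gradient \<Omega> u G)"

definition Cbar :: "'a::euclidean_space set \<Rightarrow> ('a \<Rightarrow> real) set" where
  "Cbar \<Omega> = {u. continuous_on (closure \<Omega>) u}"

text \<open>For a bounded convex domain every class in the Sobolev space has exactly one
  representative that is continuous up to the boundary. The elements of W1inf are these
  representatives, so that W1inf is contained in Cbar. Values outside the closure of the domain
  play no role.\<close>

definition W1inf :: "'a::euclidean_space set \<Rightarrow> ('a \<Rightarrow> real) set" where
  "W1inf \<Omega> = {u \<in> Cbar \<Omega>. u \<in> Linf \<Omega> \<and> (\<exists>G. has_weak_gradient \<Omega> u G \<and> G \<in> Linf \<Omega>)}"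

definition C1bar_test :: "'a::euclidean_space set \<Rightarrow> ('a \<Rightarrow> real) \<Rightarrow> ('a \<Rightarrow> 'a) \<Rightarrow> bool" where
  "C1bar_test \<Omega> \<phi> g \<longleftrightarrow> continuous_on (closure \<Omega>) \<phi> \<and> continuous_on (closure \<Omega>) g \<and>
     (\<forall>x\<in>\<Omega>. GDERIV \<phi> x :> g x)"

text \<open>The Neumann condition is built into the weak formulation: the test functions need not
  vanish on the boundary.\<close>

definition is_solution ::
  "'a::euclidean_space set \<Rightarrow> ('a \<Rightarrow> real) \<Rightarrow> real \<Rightarrow> real \<Rightarrow> ('a \<Rightarrow> real) \<Rightarrow> bool" where
  "is_solution \<Omega> a p lam u \<longleftrightarrow> u \<in> W1inf \<Omega> \<and> Linf_norm \<Omega> (wgrad \<Omega> u) < 1 \<and>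
     (\<forall>\<phi> g. C1bar_test \<Omega> \<phi> g \<longrightarrow>
        (LINT x|lebesgue_on \<Omega>. (wgrad \<Omega> u x \<bullet> g x) / sqrt (1 - (norm (wgrad \<Omega> u x))\<^sup>2)) =
        lam * (LINT x|lebesgue_on \<Omega>. a x * (\<bar>u x\<bar> powr (p - 2) * u x) * \<phi> x))"

definition K_set :: "'a::euclidean_space set \<Rightarrow> ('a \<Rightarrow> real) set" where
  "K_set \<Omega> = {u \<in> W1inf \<Omega>. Linf_norm \<Omega> (wgrad \<Omega> u) \<le> 1}"

definition Ka_set :: "'a::euclidean_space set \<Rightarrow> ('a \<Rightarrow> real) \<Rightarrow> real \<Rightarrow> ('a \<Rightarrow> real) set" where
  "Ka_set \<Omega> a p = {u \<in> K_set \<Omega>. (LINT x|lebesgue_on \<Omega>. a x * (\<bar>u x\<bar> powr (p - 2) * u x)) = 0}"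

definition J_fun :: "'a::euclidean_space set \<Rightarrow> ('a \<Rightarrow> real) \<Rightarrow> real \<Rightarrow> ('a \<Rightarrow> real) \<Rightarrow> real" where
  "J_fun \<Omega> a p u = (LINT x|lebesgue_on \<Omega>. a x * \<bar>u x\<bar> powr p)"

definition Psi_fun :: "'a::euclidean_space set \<Rightarrow> ('a \<Rightarrow> real) \<Rightarrow> ereal" where
  "Psi_fun \<Omega> u = (if u \<in> K_set \<Omega>
     then ereal (LINT x|lebesgue_on \<Omega>. 1 - sqrt (1 - (norm (wgrad \<Omega> u x))\<^sup>2)) else \<infinity>)"

definition Phi_fun ::
  "'a::euclidean_space set \<Rightarrow> ('a \<Rightarrow> real) \<Rightarrow> real \<Rightarrow> real \<Rightarrow> ('a \<Rightarrow> real) \<Rightarrow> real" where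
  "Phi_fun \<Omega> a p lam u = - (lam / p) * (LINT x|lebesgue_on \<Omega>. a x * \<bar>u x\<bar> powr p)"

definition I_fun ::
  "'a::euclidean_space set \<Rightarrow> ('a \<Rightarrow> real) \<Rightarrow> real \<Rightarrow> real \<Rightarrow> ('a \<Rightarrow> real) \<Rightarrow> ereal" where
  "I_fun \<Omega> a p lam u = Psi_fun \<Omega> u + ereal (Phi_fun \<Omega> a p lam u)"

definition admissible_set ::
  "'a::euclidean_space set \<Rightarrow> ('a \<Rightarrow> real) \<Rightarrow> ('a \<Rightarrow> real) \<Rightarrow> 'a set \<Rightarrow> bool" where
  "admissible_set \<Omega> a w U \<longleftrightarrow> open U \<and> connected U \<and> U \<subseteq> \<Omega> \<and>
     Linf_norm U (wgrad \<Omega> w) < 1 \<and> (AE x in lebesgue_on U. a x \<noteq> 0)"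

end

theory Submission
  imports Defs "HOL-Real_Asymp.Real_Asymp"
begin

text \<open>The limit \<open>u_inf\<close> maximizes \<open>J\<close> not only over the functions with
  vanishing integral condition but over the whole constraint set \<open>K\<close> of functions with
  gradient at most 1. Indeed the minimizer \<open>u lam\<close> has the least energy among all competitors, and
  the gradient part of the energy is between 0 and the volume of the domain. Dividing the energy
  inequality by \<open>lam\<close> gives \<open>J v \<le> J (u lam) + O(1 / lam)\<close> for all \<open>v\<close> in \<open>K\<close>, and
  \<open>lam \<rightarrow> \<infinity>\<close> gives \<open>J v \<le> J u_inf\<close>
  (\<open>limit_of_minimizers_maximizes_J_fun\<close>). Positivity of the maximum follows by comparison with
  a small bump supported where the weight is positive.

  Maximality over all of \<open>K\<close> carries no integral constraint, hence no Lagrange multiplier. On an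
  open set \<open>U\<close> where the gradient bound is not active, \<open>u_inf\<close> may be perturbed by small multiples of
  any test function, and the first variation gives \<open>a * u_inf powr (p - 1) = 0\<close> almost everywhere
  in \<open>U\<close> (\<open>maximizer_vanishes_where_unconstrained\<close>). So \<open>u_inf\<close> vanishes on every admissible set,
  the first alternative of the dichotomy always holds, and \<open>\<mu>\<close> may be any positive number.

  Two facts about weak gradients are needed. They are unique almost everywhere, which is the
  fundamental lemma of the calculus of variations
  (\<open>fundamental_lemma_of_calculus_of_variations\<close>). And \<open>K\<close> is closed under uniform limits
  (\<open>K_set_uniform_limit\<close>); instead of weak compactness in \<open>L\<^sup>2\<close> the proof selects gradients of
  nearly minimal norm among all functions close to the limit, and the parallelogram identity makes
  them converge (\<open>AE_Cauchy_selection\<close>).\<close>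

section \<open>The fundamental lemma of the calculus of variations\<close>

lemma continuous_on_if_GDERIV:
  "(\<And>x. GDERIV \<phi> x :> g x) \<Longrightarrow> continuous_on UNIV \<phi>"
  unfolding gderiv_def by (meson continuous_at_imp_continuous_on has_derivative_continuous)

lemma C1c_test_continuous:
  assumes "C1c_test \<Omega> \<phi> g"
  shows "continuous_on UNIV \<phi>" "continuous_on UNIV g"
  using assms continuous_on_if_GDERIV unfolding C1c_test_def by blast+

lemma DERIV_max_0_squared:
  "((\<lambda>s::real. (max 0 s)\<^sup>2) has_real_derivative 2 * max 0 s) (at s)"
proof (cases s "0::real" rule: linorder_cases)
  case less
  have "((\<lambda>s::real. 0) has_real_derivative 2 * max 0 s) (at s)"
    using less by auto
  then show ?thesis
    by (rule DERIV_cong_ev[THEN iffD1, rotated -1])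
       (use less in \<open>auto intro: eventually_mono[OF eventually_nhds_in_open[of "{..<0}"]]\<close>)
next
  case greater
  have "((\<lambda>s::real. s\<^sup>2) has_real_derivative 2 * max 0 s) (at s)"
    using greater by (auto intro!: derivative_eq_intros)
  then show ?thesis
    by (rule DERIV_cong_ev[THEN iffD1, rotated -1])
       (use greater in \<open>auto intro: eventually_mono[OF eventually_nhds_in_open[of "{0<..}"]]\<close>)
next
  case equal
  have "((\<lambda>h. (max 0 h)\<^sup>2 / h) \<longlongrightarrow> 0) (at (0::real))"
  proof (rule Lim_null_comparison)
    show "\<forall>\<^sub>F h in at (0::real). norm ((max 0 h)\<^sup>2 / h) \<le> norm h"
      by (rule always_eventually) (auto simp: max_def power2_eq_square)
  qed (auto intro!: tendsto_eq_intros)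
  then show ?thesis using equal by (simp add: DERIV_def)
qed

text \<open>The function is a product over the coordinates of
  \<open>(max 0 ((x - a) * (b - x)))\<^sup>2\<close>; squaring the positive part makes each factor, hence the
  product, continuously differentiable across the boundary of the box.\<close>

lemma box_bump:
  fixes a b :: "'a::euclidean_space"
  assumes "box a b \<noteq> {}"
  obtains q g where "\<And>x. GDERIV q x :> g x" "continuous_on UNIV g" "\<And>x. 0 \<le> q x"
    "\<And>x. 0 < q x \<longleftrightarrow> x \<in> box a b"
proof -
  define s where "s i x = (x \<bullet> i - a \<bullet> i) * (b \<bullet> i - x \<bullet> i)" for i x :: 'a
  define s' where "s' i x = (b \<bullet> i - x \<bullet> i) - (x \<bullet> i - a \<bullet> i)" for i x :: 'a
  define q where "q x = (\<Prod>i\<in>Basis. (max 0 (s i x))\<^sup>2)" for x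
  define g where "g x = (\<Sum>i\<in>Basis. (2 * max 0 (s i x) * s' i x *
       (\<Prod>j\<in>Basis - {i}. (max 0 (s j x))\<^sup>2)) *\<^sub>R i)" for x
  have s: "((s i) has_derivative (\<lambda>h. (h \<bullet> i) * s' i x)) (at x)" for i x
    unfolding s_def s'_def by (auto intro!: derivative_eq_intros simp: algebra_simps)
  have 1: "((\<lambda>x. (max 0 (s i x))\<^sup>2) has_derivative (\<lambda>h. 2 * max 0 (s i x) * ((h \<bullet> i) * s' i x))) (at x)"
    for i x
    using has_derivative_compose[OF s DERIV_max_0_squared[unfolded has_field_derivative_def]]
    by simp
  have "(q has_derivative (\<lambda>h. h \<bullet> g x)) (at x)" for x
    unfolding q_def
    by (rule has_derivative_eq_rhs[OF has_derivative_prod[OF 1]])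
       (auto simp: g_def inner_sum_right fun_eq_iff mult_ac intro!: sum.cong)
  moreover have "continuous_on UNIV g"
    unfolding g_def s_def s'_def by (intro continuous_intros)
  moreover have "0 \<le> q x" for x unfolding q_def by (auto intro: prod_nonneg)
  moreover have "0 < q x \<longleftrightarrow> x \<in> box a b" for x
  proof -
    have *: "0 < s i x \<longleftrightarrow> a \<bullet> i < x \<bullet> i \<and> x \<bullet> i < b \<bullet> i" if "i \<in> Basis" for i
      using assms[unfolded box_ne_empty, rule_format, OF that]
      by (auto simp: s_def zero_less_mult_iff)
    have "0 < q x \<longleftrightarrow> q x \<noteq> 0" using \<open>0 \<le> q x\<close> by auto
    also have "\<dots> \<longleftrightarrow> x \<in> box a b"
      using * by (auto simp: q_def mem_box max_def less_le)
    finally show ?thesis .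
  qed
  ultimately show ?thesis using that unfolding gderiv_def by blast
qed

text \<open>The gradient of a test function vanishes off the same compact set, because the function is zero
  on the open complement; boundedness of both follows by compactness.\<close>

lemma C1c_test_E:
  assumes "C1c_test \<Omega> \<phi> g"
  obtains C B where "compact C" "C \<subseteq> \<Omega>" "\<And>x. x \<notin> C \<Longrightarrow> \<phi> x = 0" "\<And>x. x \<notin> C \<Longrightarrow> g x = 0"
    "0 \<le> B" "\<And>x. \<bar>\<phi> x\<bar> \<le> B" "\<And>x. norm (g x) \<le> B"
proof -
  from assms obtain C where D: "\<And>x. GDERIV \<phi> x :> g x" and g: "continuous_on UNIV g"
    and C: "compact C" "C \<subseteq> \<Omega>" "\<And>x. x \<notin> C \<Longrightarrow> \<phi> x = 0"
    unfolding C1c_test_def by blast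
  have g0: "g x = 0" if "x \<notin> C" for x
  proof -
    have "(\<phi> has_derivative (\<lambda>h. 0)) (at x)"
    proof (rule has_derivative_transform_within_open[OF has_derivative_const[of 0]])
      show "open (- C)" using C(1) by (simp add: compact_imp_closed open_Compl)
    qed (use that C(3) in auto)
    from has_derivative_unique[OF this D[of x, unfolded gderiv_def]]
    have "g x \<bullet> g x = 0" by metis
    then show ?thesis by simp
  qed
  have cphi: "continuous_on UNIV \<phi>" by (rule continuous_on_if_GDERIV[OF D])
  have "bounded (\<phi> ` C)" "bounded (g ` C)"
    by (intro compact_imp_bounded compact_continuous_image C(1)
      continuous_on_subset[OF cphi subset_UNIV] continuous_on_subset[OF g subset_UNIV])+
  then obtain B1 B2 where B: "\<And>x. x \<in> C \<Longrightarrow> norm (\<phi> x) \<le> B1" "\<And>x. x \<in> C \<Longrightarrow> norm (g x) \<le> B2"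
    unfolding bounded_iff by auto
  define M where "M = max 0 (max B1 B2)"
  have M: "0 \<le> M" "B1 \<le> M" "B2 \<le> M" by (auto simp: M_def)
  have "\<bar>\<phi> x\<bar> \<le> M" "norm (g x) \<le> M" for x
    using C(3) g0 B[of x] M by (cases "x \<in> C"; simp; linarith)+
  then show thesis using that[OF C g0 M(1)] by blast
qed

text \<open>With a bump \<open>q\<close> that is positive exactly on the open box, the test functions
  \<open>k * q / (1 + k * q)\<close> are bounded by 1 and increase to the indicator function of the box, so
  dominated convergence turns orthogonality to test functions into vanishing box integrals.\<close>

lemma integral_box_eq_0_if_orthogonal_to_tests:
  fixes f :: "'a::euclidean_space \<Rightarrow> 'b::euclidean_space"
  assumes "open \<Omega>"
    and f: "\<And>C. compact C \<Longrightarrow> C \<subseteq> \<Omega> \<Longrightarrow> f absolutely_integrable_on C"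
    and zero: "\<And>\<phi> g. C1c_test \<Omega> \<phi> g \<Longrightarrow> (LINT x|lebesgue_on \<Omega>. \<phi> x *\<^sub>R f x) = 0"
    and sub: "cbox a b \<subseteq> \<Omega>"
  shows "integral (cbox a b) f = 0"
proof (cases "box a b = {}")
  case True
  then show ?thesis
    using integral_open_interval[of a b f] by simp
next
  case False
  obtain q g where q: "\<And>x. GDERIV q x :> g x" "continuous_on UNIV g" "\<And>x. 0 \<le> q x"
    "\<And>x. 0 < q x \<longleftrightarrow> x \<in> box a b"
    using box_bump[OF False] by blast
  have q0: "q x = 0" if "x \<notin> box a b" for x using q(3,4)[of x] that by auto
  have cq: "continuous_on UNIV q" by (rule continuous_on_if_GDERIV[OF q(1)])
  define \<phi> where "\<phi> k x = real k * q x / (1 + real k * q x)" for k :: nat and x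
  define \<gamma> where "\<gamma> k x = (real k / (1 + real k * q x)\<^sup>2) *\<^sub>R g x" for k :: nat and x
  have pos: "1 + real k * q x > 0" for k x
    using q(3)[of x] by (simp add: add_pos_nonneg)
  have test: "C1c_test \<Omega> (\<phi> k) (\<gamma> k)" for k
    unfolding C1c_test_def
  proof (intro conjI allI)
    fix x
    have "((\<lambda>s. real k * s / (1 + real k * s)) has_real_derivative
            (real k / (1 + real k * q x)\<^sup>2)) (at (q x))"
      using pos[of k x]
      by (auto intro!: derivative_eq_intros simp: field_simps power2_eq_square)
    then show "GDERIV (\<phi> k) x :> \<gamma> k x"
      unfolding \<phi>_def \<gamma>_def by (rule GDERIV_DERIV_compose[OF q(1)])
  next
    show "continuous_on UNIV (\<gamma> k)"
      unfolding \<gamma>_def using pos[of k]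
      by (intro continuous_intros q(2) cq) (auto simp: less_le)
  next
    show "\<exists>C. compact C \<and> C \<subseteq> \<Omega> \<and> (\<forall>x. x \<notin> C \<longrightarrow> \<phi> k x = 0)"
      using sub q0 box_subset_cbox[of a b] by (intro exI[of _ "cbox a b"]) (auto simp: \<phi>_def)
  qed
  have bound: "0 \<le> \<phi> k x" "\<phi> k x \<le> 1" for k x
    using pos[of k x] q(3)[of x] by (auto simp: \<phi>_def divide_simps)
  have conv: "(\<lambda>k. \<phi> k x) \<longlonglongrightarrow> indicator (box a b) x" for x
  proof (cases "x \<in> box a b")
    case True
    then have "q x > 0" using q(4) by simp
    then have "(\<lambda>k. real k * q x / (1 + real k * q x)) \<longlonglongrightarrow> 1" by real_asymp
    then show ?thesis using True by (simp add: \<phi>_def)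
  next
    case False
    then show ?thesis using q0 by (simp add: \<phi>_def)
  qed
  have fc: "f absolutely_integrable_on cbox a b" using f[OF compact_cbox sub] .
  define f1 where "f1 x = indicator (cbox a b) x *\<^sub>R f x" for x
  have f1: "integrable lebesgue f1"
    using fc unfolding set_integrable_def f1_def .
  have [measurable]: "\<phi> k \<in> borel_measurable lebesgue" for k
  proof -
    have "continuous_on UNIV (\<phi> k)"
      unfolding \<phi>_def using pos[of k] by (intro continuous_intros cq) (auto simp: less_le)
    then show ?thesis by (simp add: borel_measurable_continuous_onI measurable_completion)
  qed
  have [measurable]: "f1 \<in> borel_measurable lebesgue" using f1 by simp
  have test_int: "(LINT x|lebesgue. \<phi> k x *\<^sub>R f1 x) = 0" for k
  proof -
    have "indicator \<Omega> x *\<^sub>R \<phi> k x *\<^sub>R f x = \<phi> k x *\<^sub>R f1 x" for x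
      using sub q0[of x] box_subset_cbox[of a b] by (cases "x \<in> cbox a b") (auto simp: f1_def \<phi>_def)
    then have "(LINT x|lebesgue_on \<Omega>. \<phi> k x *\<^sub>R f x) = (LINT x|lebesgue. \<phi> k x *\<^sub>R f1 x)"
      using \<open>open \<Omega>\<close> by (subst integral_restrict_space) auto
    then show ?thesis using zero[OF test] by simp
  qed
  have "(\<lambda>k. LINT x|lebesgue. \<phi> k x *\<^sub>R f1 x) \<longlonglongrightarrow> (LINT x|lebesgue. indicator (box a b) x *\<^sub>R f1 x)"
  proof (rule integral_dominated_convergence)
    show "integrable lebesgue (\<lambda>x. norm (f1 x))" using f1 by simp
    show "AE x in lebesgue. (\<lambda>k. \<phi> k x *\<^sub>R f1 x) \<longlonglongrightarrow> indicator (box a b) x *\<^sub>R f1 x"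
      by (intro AE_I2 tendsto_intros conv)
    show "AE x in lebesgue. norm (\<phi> k x *\<^sub>R f1 x) \<le> norm (f1 x)" for k
      using bound[of k] by (intro AE_I2) (auto intro: mult_left_le_one_le)
    have "indicat_real (box a b) \<in> borel_measurable lebesgue"
      by (intro borel_measurable_indicator) auto
    then show "(\<lambda>x. indicat_real (box a b) x *\<^sub>R f1 x) \<in> borel_measurable lebesgue" by measurable
  qed auto
  then have "(LINT x|lebesgue. indicator (box a b) x *\<^sub>R f1 x) = 0"
    using test_int by (simp add: LIMSEQ_const_iff)
  moreover have "indicator (box a b) x *\<^sub>R f1 x = indicator (box a b) x *\<^sub>R f x" for x
    using box_subset_cbox[of a b] by (auto simp: f1_def indicator_def)
  ultimately have "set_lebesgue_integral lebesgue (box a b) f = 0"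
    by (simp add: set_lebesgue_integral_def)
  moreover have "set_integrable lebesgue (box a b) f"
    by (rule set_integrable_subset[OF fc _ box_subset_cbox]) auto
  ultimately have "integral (box a b) f = 0"
    using set_lebesgue_integral_eq_integral(2) by metis
  then show ?thesis by (simp add: integral_open_interval)
qed

text \<open>By Lebesgue differentiation along small cubes, almost every value of a function is the limit of
  its cube averages. The function is extended by zero because the differentiation theorem speaks of
  functions that are integrable on every box.\<close>

lemma negligible_if_integral_boxes_eq_0:
  fixes f :: "'a::euclidean_space \<Rightarrow> 'b::euclidean_space"
  assumes f: "f integrable_on cbox c d"
    and zero: "\<And>a b. cbox a b \<subseteq> cbox c d \<Longrightarrow> integral (cbox a b) f = 0"
  shows "negligible {x \<in> box c d. f x \<noteq> 0}"
proof -
  define h where "h x = (if x \<in> cbox c d then f x else 0)" for x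
  have "h integrable_on cbox a b" for a b
  proof -
    obtain u v where uv: "cbox c d \<inter> cbox a b = cbox u v" by (rule that, rule Int_interval)
    then have "cbox u v \<subseteq> cbox c d" by (metis Int_lower1)
    then have "f integrable_on cbox u v" by (rule integrable_on_subcbox[OF f])
    then show ?thesis unfolding h_def integrable_restrict_Int uv .
  qed
  then obtain N where N: "negligible N"
    "\<And>x e. \<lbrakk>x \<notin> N; 0 < e\<rbrakk> \<Longrightarrow> \<exists>\<delta>>0. \<forall>t. 0 < t \<and> t < \<delta> \<longrightarrow>
        norm (integral (cbox x (x + t *\<^sub>R One)) h /\<^sub>R t ^ DIM('a) - h x) < e"
    by (rule integrable_ccontinuous_explicit[of h]) (rule that)
  have "f x = 0" if x: "x \<in> box c d" "x \<notin> N" for x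
  proof -
    have "norm (f x) \<le> e" if e: "0 < e" for e
    proof -
      obtain \<delta> where \<delta>: "\<delta> > 0" "\<And>t. 0 < t \<and> t < \<delta> \<Longrightarrow>
          norm (integral (cbox x (x + t *\<^sub>R One)) h /\<^sub>R t ^ DIM('a) - h x) < e"
        using N(2)[OF x(2) e] by (elim exE conjE) (rule that, auto)
      obtain r where r: "r > 0" "cball x r \<subseteq> box c d"
        using open_contains_cball[of "box c d"] x(1) open_box[of c d] by auto
      \<comment> \<open>a cube of side t has l1-diameter t * DIM, which must not exceed r\<close>
      define t where "t = min (\<delta> / 2) (r / DIM('a))"
      have t: "0 < t" "t < \<delta>" using \<delta>(1) r(1) by (auto simp: t_def)
      have "t \<le> r / DIM('a)" by (simp add: t_def)
      then have tr: "t * DIM('a) \<le> r" by (simp add: pos_le_divide_eq)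
      have "cbox x (x + t *\<^sub>R One) \<subseteq> cball x r"
      proof
        fix y assume y: "y \<in> cbox x (x + t *\<^sub>R One)"
        have "norm (y - x) \<le> (\<Sum>i\<in>Basis. \<bar>(y - x) \<bullet> i\<bar>)" by (rule norm_le_l1)
        also have "\<dots> \<le> (\<Sum>i\<in>(Basis::'a set). t)"
          using y by (intro sum_mono) (auto simp: mem_box inner_diff_left inner_add_left abs_le_iff)
        also have "\<dots> \<le> r" using tr by (simp add: mult.commute)
        finally show "y \<in> cball x r" by (simp add: dist_norm norm_minus_commute)
      qed
      then have sub: "cbox x (x + t *\<^sub>R One) \<subseteq> cbox c d" using r(2) box_subset_cbox[of c d] by order
      have "integral (cbox x (x + t *\<^sub>R One)) h = integral (cbox x (x + t *\<^sub>R One)) f"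
        using sub by (intro integral_cong) (auto simp: h_def)
      also have "\<dots> = 0" by (rule zero[OF sub])
      finally have "norm (h x) < e" using \<delta>(2)[of t] t by simp
      moreover have "h x = f x" using subsetD[OF box_subset_cbox x(1)] by (simp add: h_def)
      ultimately show ?thesis by simp
    qed
    then have "norm (f x) \<le> 0" by (rule dense_ge)
    then show ?thesis by simp
  qed
  then show ?thesis by (intro negligible_subset[OF N(1)]) auto
qed

lemma AE_lebesgue_on_iff_negligible:
  "S \<in> sets lebesgue \<Longrightarrow> (AE x in lebesgue_on S. P x) \<longleftrightarrow> negligible {x \<in> S. \<not> P x}"
proof
  assume "S \<in> sets lebesgue" "AE x in lebesgue_on S. P x"
  then obtain N where "N \<in> null_sets (lebesgue_on S)" "{x \<in> S. \<not> P x} \<subseteq> N"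
    by (auto simp: eventually_ae_filter)
  then show "negligible {x \<in> S. \<not> P x}"
    using \<open>S \<in> sets lebesgue\<close> negligible_subset[of N]
    by (simp add: null_sets_restrict_space negligible_iff_null_sets)
next
  assume "S \<in> sets lebesgue" "negligible {x \<in> S. \<not> P x}"
  then have "{x \<in> S. \<not> P x} \<in> null_sets (lebesgue_on S)"
    by (auto simp: null_sets_restrict_space negligible_iff_null_sets)
  then show "AE x in lebesgue_on S. P x" by (rule AE_I') auto
qed

theorem fundamental_lemma_of_calculus_of_variations:
  fixes f :: "'a::euclidean_space \<Rightarrow> 'b::euclidean_space"
  assumes "open \<Omega>"
    and f: "\<And>C. compact C \<Longrightarrow> C \<subseteq> \<Omega> \<Longrightarrow> f absolutely_integrable_on C"
    and zero: "\<And>\<phi> g. C1c_test \<Omega> \<phi> g \<Longrightarrow> (LINT x|lebesgue_on \<Omega>. \<phi> x *\<^sub>R f x) = 0"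
  shows "AE x in lebesgue_on \<Omega>. f x = 0"
proof -
  obtain D where D: "countable D" "D \<subseteq> Pow \<Omega>" "\<And>X. X \<in> D \<Longrightarrow> \<exists>c d. X = cbox c d" "\<Union>D = \<Omega>"
    by (rule open_countable_Union_open_cbox[OF \<open>open \<Omega>\<close>]) (rule that)
  have neg: "negligible {x \<in> X. f x \<noteq> 0}" if X: "X \<in> D" for X
  proof -
    obtain c d where cd: "X = cbox c d" "cbox c d \<subseteq> \<Omega>" using D(2,3) X by blast
    have "negligible {x \<in> box c d. f x \<noteq> 0}"
    proof (rule negligible_if_integral_boxes_eq_0)
      show "f integrable_on cbox c d"
        by (rule set_lebesgue_integral_eq_integral(1)[OF f[OF compact_cbox cd(2)]])
      show "integral (cbox a b) f = 0" if "cbox a b \<subseteq> cbox c d" for a b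
        by (rule integral_box_eq_0_if_orthogonal_to_tests[OF \<open>open \<Omega>\<close>])
           (use that cd(2) f zero in auto)
    qed
    then have "negligible ({x \<in> box c d. f x \<noteq> 0} \<union> (cbox c d - box c d))"
      by (intro negligible_Un negligible_frontier_interval)
    then show ?thesis by (rule negligible_subset) (use cd(1) in auto)
  qed
  have "negligible (\<Union>((\<lambda>X. {x \<in> X. f x \<noteq> 0}) ` D))"
    by (rule negligible_countable_Union) (use D(1) neg in auto)
  moreover have "\<Union>((\<lambda>X. {x \<in> X. f x \<noteq> 0}) ` D) = {x \<in> \<Omega>. f x \<noteq> 0}" using D(4) by blast
  moreover have "\<Omega> \<in> sets lebesgue" using \<open>open \<Omega>\<close> by auto
  ultimately show ?thesis by (simp add: AE_lebesgue_on_iff_negligible)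
qed

section \<open>Weak gradients\<close>

text \<open>Translation invariance of Lebesgue measure makes the integral of every difference quotient zero.
  The difference quotients are dominated, since the gradient is bounded and the supports stay in one
  ball, and they converge to the directional derivative.\<close>

lemma integral_gradient_eq_0:
  fixes \<psi> :: "'a::euclidean_space \<Rightarrow> real"
  assumes test: "C1c_test UNIV \<psi> g"
  shows "(LINT x|lebesgue. g x) = 0"
proof -
  from test have D: "\<And>x. GDERIV \<psi> x :> g x" by (auto simp: C1c_test_def)
  obtain C B where C: "compact C" "\<And>x. x \<notin> C \<Longrightarrow> \<psi> x = 0" "\<And>x. x \<notin> C \<Longrightarrow> g x = 0"
    "0 \<le> B" "\<And>x. \<bar>\<psi> x\<bar> \<le> B" "\<And>x. norm (g x) \<le> B"
    using C1c_test_E[OF test] by metis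
  obtain R where R: "R > 0" "\<And>x. x \<in> C \<Longrightarrow> norm x \<le> R"
    using compact_imp_bounded[OF C(1)] unfolding bounded_pos by blast
  have outside: "x \<notin> C" if "R + 1 < norm x" for x using R(2)[of x] that by auto
  note cont = C1c_test_continuous[OF test]
  have [measurable]: "\<psi> \<in> borel_measurable borel" "g \<in> borel_measurable borel"
    using cont by (auto intro: borel_measurable_continuous_onI)
  have int_ball: "integrable lborel (\<lambda>x. B * indicator (cball (0::'a) (R + 1)) x)"
    using emeasure_bounded_finite[OF bounded_cball, of "0::'a" "R + 1"]
    by (intro integrable_mult_right integrable_real_indicator) (auto simp: less_top)
  have int_\<psi>: "integrable lborel \<psi>"
  proof (rule Bochner_Integration.integrable_bound[OF int_ball])
    show "AE x in lborel. norm (\<psi> x) \<le> norm (B * indicator (cball 0 (R + 1)) x)"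
      using C(2-6) outside by (intro AE_I2) (auto simp: indicator_def)
  qed simp
  have int_g: "integrable lborel g"
  proof (rule Bochner_Integration.integrable_bound[OF int_ball])
    show "AE x in lborel. norm (g x) \<le> norm (B * indicator (cball 0 (R + 1)) x)"
      using C(2-6) outside by (intro AE_I2) (auto simp: indicator_def)
  qed simp
  have "(LINT x|lborel. g x \<bullet> i) = 0" if i: "i \<in> Basis" for i
  proof -
    define t where "t n = 1 / real (Suc n)" for n
    have t: "0 < t n" "t n \<le> 1" for n by (auto simp: t_def)
    define Q where "Q n x = (\<psi> (t n *\<^sub>R i + x) - \<psi> x) / t n" for n x
    have "(LINT x|lborel. \<psi> (t n *\<^sub>R i + x)) = (LINT x|lborel. \<psi> x)" for n
      using integral_distr[of "(+) (t n *\<^sub>R i)" lborel borel \<psi>] by (simp add: lborel_distr_plus)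
    moreover have "integrable lborel (\<lambda>x. \<psi> (t n *\<^sub>R i + x))" for n
      using integrable_distr_eq[of "(+) (t n *\<^sub>R i)" lborel borel \<psi>] int_\<psi>
      by (simp add: lborel_distr_plus)
    ultimately have Q0: "(LINT x|lborel. Q n x) = 0" for n
      unfolding Q_def using int_\<psi> by simp
    have lip: "\<bar>\<psi> y - \<psi> x\<bar> \<le> B * norm (y - x)" for x y
    proof -
      have "norm (\<psi> y - \<psi> x) \<le> B * norm (y - x)"
      proof (rule differentiable_bound[OF convex_UNIV])
        show "(\<psi> has_derivative (\<lambda>h. h \<bullet> g x)) (at x within UNIV)" for x
          using D by (simp add: gderiv_def)
        show "onorm (\<lambda>h. h \<bullet> g x) \<le> B" for x
        proof (rule onorm_bound[OF C(4)])
          fix h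
          have "norm (h \<bullet> g x) \<le> norm h * norm (g x)" by (simp add: Cauchy_Schwarz_ineq2)
          also have "\<dots> \<le> norm h * B" using C(6) by (intro mult_left_mono) auto
          finally show "norm (h \<bullet> g x) \<le> B * norm h" by (simp add: mult.commute)
        qed
      qed auto
      then show ?thesis by simp
    qed
    have "(\<lambda>n. LINT x|lborel. Q n x) \<longlonglongrightarrow> (LINT x|lborel. g x \<bullet> i)"
    proof (rule integral_dominated_convergence[OF _ _ int_ball])
      show "AE x in lborel. (\<lambda>n. Q n x) \<longlonglongrightarrow> g x \<bullet> i"
      proof (rule AE_I2)
        fix x
        have "((\<lambda>s. x + s *\<^sub>R i) has_derivative (\<lambda>s. s *\<^sub>R i)) (at 0)"
          by (auto intro!: derivative_eq_intros)
        moreover have "(\<psi> has_derivative (\<lambda>h. h \<bullet> g x)) (at (x + 0 *\<^sub>R i))"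
          using D by (simp add: gderiv_def)
        ultimately have "((\<lambda>s. \<psi> (x + s *\<^sub>R i)) has_derivative (\<lambda>s. (s *\<^sub>R i) \<bullet> g x)) (at 0)"
          by (rule has_derivative_compose)
        then have "((\<lambda>s. \<psi> (x + s *\<^sub>R i)) has_real_derivative g x \<bullet> i) (at 0)"
          by (simp add: has_field_derivative_def inner_commute mult_commute_abs)
        then have "((\<lambda>s. (\<psi> (x + s *\<^sub>R i) - \<psi> x) / s) \<longlongrightarrow> g x \<bullet> i) (at 0)"
          by (simp add: DERIV_def)
        moreover have "filterlim t (at 0) sequentially"
        proof -
          have "t \<longlonglongrightarrow> 0" unfolding t_def[abs_def] by real_asymp
          moreover have "t n \<noteq> 0" for n using t(1)[of n] by simp
          ultimately show ?thesis by (simp add: filterlim_at)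
        qed
        ultimately show "(\<lambda>n. Q n x) \<longlonglongrightarrow> g x \<bullet> i"
          unfolding Q_def by (auto dest: filterlim_compose simp: add.commute)
      qed
      show "AE x in lborel. norm (Q n x) \<le> B * indicator (cball 0 (R + 1)) x" for n
      proof (rule AE_I2)
        fix x
        show "norm (Q n x) \<le> B * indicator (cball 0 (R + 1)) x"
        proof (cases "x \<in> cball 0 (R + 1)")
          case True
          then show ?thesis
            using lip[of "t n *\<^sub>R i + x" x] t[of n] i by (simp add: Q_def divide_simps)
        next
          case False
          have "norm x \<le> norm (t n *\<^sub>R i + x) + t n"
            using norm_triangle_ineq4[of "t n *\<^sub>R i + x" "t n *\<^sub>R i"] t[of n] i by simp
          then have "x \<notin> C" "t n *\<^sub>R i + x \<notin> C" using False R(2) t[of n] by force+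
          then show ?thesis using C(2,4) by (simp add: Q_def)
        qed
      qed
    qed (auto simp: Q_def)
    then show ?thesis using Q0 by (simp add: LIMSEQ_const_iff)
  qed
  then have "(LINT x|lborel. g x) \<bullet> i = 0 \<bullet> i" if "i \<in> Basis" for i
    using that integral_inner_left[of i lborel g] int_g by simp
  then have "(LINT x|lborel. g x) = 0" by (rule euclidean_eqI)
  then show ?thesis by (simp add: integral_completion)
qed

lemma integral_lebesgue_on_eq:
  fixes f :: "'a::euclidean_space \<Rightarrow> 'b::euclidean_space"
  assumes "\<Omega> \<in> sets lebesgue" "\<And>x. x \<notin> \<Omega> \<Longrightarrow> f x = 0"
  shows "(LINT x|lebesgue_on \<Omega>. f x) = (LINT x|lebesgue. f x)"
  using assms by (subst integral_restrict_space)
    (auto intro!: Bochner_Integration.integral_cong simp: indicator_def)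

lemma integrable_product_compact_support:
  fixes k :: "'a::euclidean_space \<Rightarrow> 'b::euclidean_space" and h :: "'b \<Rightarrow> 'c::euclidean_space \<Rightarrow> 'd::euclidean_space"
  assumes "bilinear h" "open \<Omega>" and k: "continuous_on UNIV k" and C: "compact C" "C \<subseteq> \<Omega>"
    and k0: "\<And>x. x \<notin> C \<Longrightarrow> k x = 0" and F: "F absolutely_integrable_on C"
  shows "integrable (lebesgue_on \<Omega>) (\<lambda>x. h (k x) (F x))"
proof -
  have Cm: "C \<in> sets lebesgue" using C(1) by (simp add: compact_imp_closed)
  have "(\<lambda>x. h (k x) (F x)) absolutely_integrable_on C"
  proof (rule absolutely_integrable_bounded_measurable_product[OF assms(1) _ Cm _ F])
    show "k \<in> borel_measurable (lebesgue_on C)"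
      using k Cm by (meson continuous_imp_measurable_on_sets_lebesgue continuous_on_subset subset_UNIV)
    show "bounded (k ` C)"
      using k C(1) by (meson compact_continuous_image compact_imp_bounded continuous_on_subset subset_UNIV)
  qed
  moreover have "indicator C x *\<^sub>R h (k x) (F x) = indicator \<Omega> x *\<^sub>R h (k x) (F x)" for x
    using k0[of x] C(2) bilinear_lzero[OF assms(1)] by (cases "x \<in> C") (auto simp: indicator_def)
  ultimately show ?thesis
    using \<open>open \<Omega>\<close> by (simp add: set_integrable_def integrable_restrict_space)
qed

lemma integrable_test_scaleR:
  fixes F :: "'a::euclidean_space \<Rightarrow> 'b::euclidean_space"
  assumes "open \<Omega>" "C1c_test \<Omega> \<phi> g"
    and F: "\<And>C. compact C \<Longrightarrow> C \<subseteq> \<Omega> \<Longrightarrow> F absolutely_integrable_on C"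
  shows "integrable (lebesgue_on \<Omega>) (\<lambda>x. \<phi> x *\<^sub>R F x)"
proof -
  obtain C where C: "compact C" "C \<subseteq> \<Omega>" "\<And>x. x \<notin> C \<Longrightarrow> \<phi> x = 0"
    using C1c_test_E[OF assms(2)] by metis
  show ?thesis
    by (rule integrable_product_compact_support[OF _ \<open>open \<Omega>\<close> C1c_test_continuous(1)[OF assms(2)] C F[OF C(1,2)]])
       (auto simp: bilinear_conv_bounded_bilinear bounded_bilinear_scaleR)
qed

lemma integrable_scaleR_test_gradient:
  fixes F :: "'a::euclidean_space \<Rightarrow> real"
  assumes "open \<Omega>" "C1c_test \<Omega> \<phi> g"
    and F: "\<And>C. compact C \<Longrightarrow> C \<subseteq> \<Omega> \<Longrightarrow> F absolutely_integrable_on C"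
  shows "integrable (lebesgue_on \<Omega>) (\<lambda>x. F x *\<^sub>R g x)"
proof -
  obtain C where C: "compact C" "C \<subseteq> \<Omega>" "\<And>x. x \<notin> C \<Longrightarrow> g x = 0"
    using C1c_test_E[OF assms(2)] by metis
  show ?thesis
    by (rule integrable_product_compact_support[of "\<lambda>v r. r *\<^sub>R v", OF _ \<open>open \<Omega>\<close> C1c_test_continuous(2)[OF assms(2)] C F[OF C(1,2)]])
       (auto simp: bilinear_conv_bounded_bilinear
          intro: bounded_bilinear.flip[OF bounded_bilinear_scaleR])
qed

lemma absolutely_integrable_on_compact_continuous:
  fixes f :: "'a::euclidean_space \<Rightarrow> 'b::euclidean_space"
  assumes "compact C" "continuous_on C f"
  shows "f absolutely_integrable_on C"
proof -
  have C: "C \<in> lmeasurable" "C \<in> sets lebesgue"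
    using assms(1) by (auto intro: lmeasurable_compact fmeasurableD)
  obtain B where B: "\<And>x. x \<in> C \<Longrightarrow> norm (f x) \<le> B"
    using compact_imp_bounded[OF compact_continuous_image[OF assms(2,1)]] unfolding bounded_iff by auto
  show ?thesis
    by (rule measurable_bounded_by_integrable_imp_absolutely_integrable
        [OF continuous_imp_measurable_on_sets_lebesgue[OF assms(2) C(2)] C(2) integrable_on_const[OF C(1)] B])
qed

lemma has_weak_gradientD:
  assumes "has_weak_gradient \<Omega> u G"
  shows "compact C \<Longrightarrow> C \<subseteq> \<Omega> \<Longrightarrow> u absolutely_integrable_on C"
    "C1c_test \<Omega> \<phi> g \<Longrightarrow>
      (LINT x|lebesgue_on \<Omega>. u x *\<^sub>R g x) = - (LINT x|lebesgue_on \<Omega>. \<phi> x *\<^sub>R G x)"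
    "compact C \<Longrightarrow> C \<subseteq> \<Omega> \<Longrightarrow> G absolutely_integrable_on C"
  using assms unfolding has_weak_gradient_def by blast+

text \<open>Integration by parts: the product with a test function has compact support, so its gradient has
  integral zero.\<close>

lemma has_weak_gradient_C1:
  assumes "open \<Omega>" and D: "\<And>x. GDERIV \<psi> x :> g x" and g: "continuous_on UNIV g"
  shows "has_weak_gradient \<Omega> \<psi> g"
  unfolding has_weak_gradient_def
proof (intro conjI allI impI)
  have \<psi>: "continuous_on UNIV \<psi>" using continuous_on_if_GDERIV[OF D] .
  have ac: "\<psi> absolutely_integrable_on C" "g absolutely_integrable_on C" if "compact C" for C
    using \<psi> g that by (auto intro: absolutely_integrable_on_compact_continuous continuous_on_subset)
  fix \<phi> h assume t: "C1c_test \<Omega> \<phi> h"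
  obtain C where C: "compact C" "C \<subseteq> \<Omega>" "\<And>x. x \<notin> C \<Longrightarrow> \<phi> x = 0" "\<And>x. x \<notin> C \<Longrightarrow> h x = 0"
    using C1c_test_E[OF t] by metis
  have "C1c_test UNIV (\<lambda>x. \<psi> x * \<phi> x) (\<lambda>x. \<psi> x *\<^sub>R h x + \<phi> x *\<^sub>R g x)"
    unfolding C1c_test_def
  proof (intro conjI allI)
    show "GDERIV (\<lambda>x. \<psi> x * \<phi> x) x :> \<psi> x *\<^sub>R h x + \<phi> x *\<^sub>R g x" for x
      using t D by (intro GDERIV_mult) (auto simp: C1c_test_def)
    show "continuous_on UNIV (\<lambda>x. \<psi> x *\<^sub>R h x + \<phi> x *\<^sub>R g x)"
      by (intro continuous_intros \<psi> g C1c_test_continuous[OF t])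
    show "\<exists>C. compact C \<and> C \<subseteq> UNIV \<and> (\<forall>x. x \<notin> C \<longrightarrow> \<psi> x * \<phi> x = 0)" using C by auto
  qed
  note 0 = integral_gradient_eq_0[OF this]
  have "(LINT x|lebesgue_on \<Omega>. \<psi> x *\<^sub>R h x + \<phi> x *\<^sub>R g x) = 0"
  proof (subst integral_lebesgue_on_eq)
    fix x assume "x \<notin> \<Omega>"
    then have "x \<notin> C" using C(2) by auto
    then show "\<psi> x *\<^sub>R h x + \<phi> x *\<^sub>R g x = 0" by (simp add: C(3,4))
  qed (use 0 \<open>open \<Omega>\<close> in auto)
  then show "(LINT x|lebesgue_on \<Omega>. \<psi> x *\<^sub>R h x) = - (LINT x|lebesgue_on \<Omega>. \<phi> x *\<^sub>R g x)"
    using integrable_test_scaleR[OF \<open>open \<Omega>\<close> t ac(2)]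
      integrable_scaleR_test_gradient[OF \<open>open \<Omega>\<close> t ac(1)]
    by (simp add: eq_neg_iff_add_eq_0)
next
  fix C :: "'a set" assume "compact C \<and> C \<subseteq> \<Omega>"
  then show "\<psi> absolutely_integrable_on C" "g absolutely_integrable_on C"
    using continuous_on_if_GDERIV[OF D] g
    by (auto intro: absolutely_integrable_on_compact_continuous continuous_on_subset)
qed

text \<open>The difference of two weak gradients is orthogonal to all test functions. Since \<^const>\<open>wgrad\<close> picks
  an arbitrary weak gradient, this is what allows statements about it to be proved for, or
  transferred to, any other representative.\<close>

theorem has_weak_gradient_unique:
  assumes "open \<Omega>" and G: "has_weak_gradient \<Omega> u G" and H: "has_weak_gradient \<Omega> u H"
  shows "AE x in lebesgue_on \<Omega>. G x = H x"
proof -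
  have "AE x in lebesgue_on \<Omega>. G x - H x = 0"
  proof (rule fundamental_lemma_of_calculus_of_variations[OF \<open>open \<Omega>\<close>])
    show "(\<lambda>x. G x - H x) absolutely_integrable_on C" if "compact C" "C \<subseteq> \<Omega>" for C
      by (intro set_integral_diff has_weak_gradientD(3)[OF G] has_weak_gradientD(3)[OF H] that)
    fix \<phi> g assume t: "C1c_test \<Omega> \<phi> g"
    have "integrable (lebesgue_on \<Omega>) (\<lambda>x. \<phi> x *\<^sub>R G x)" "integrable (lebesgue_on \<Omega>) (\<lambda>x. \<phi> x *\<^sub>R H x)"
      using has_weak_gradientD(3)[OF G] has_weak_gradientD(3)[OF H]
      by (intro integrable_test_scaleR[OF \<open>open \<Omega>\<close> t]; simp)+
    moreover have "- (LINT x|lebesgue_on \<Omega>. \<phi> x *\<^sub>R G x) = - (LINT x|lebesgue_on \<Omega>. \<phi> x *\<^sub>R H x)"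
      using has_weak_gradientD(2)[OF G t] has_weak_gradientD(2)[OF H t] by (rule trans[OF sym])
    ultimately show "(LINT x|lebesgue_on \<Omega>. \<phi> x *\<^sub>R (G x - H x)) = 0"
      by (simp add: scaleR_diff_right)
  qed
  then show ?thesis by simp
qed

lemma has_weak_gradient_cong_AE:
  assumes "open \<Omega>" and G: "has_weak_gradient \<Omega> u G" and ae: "AE x in lebesgue_on \<Omega>. G x = H x"
  shows "has_weak_gradient \<Omega> u H"
proof -
  have neg: "negligible {x \<in> \<Omega>. G x \<noteq> H x}"
    using ae \<open>open \<Omega>\<close> by (simp add: AE_lebesgue_on_iff_negligible)
  have H: "H absolutely_integrable_on C" if "compact C" "C \<subseteq> \<Omega>" for C
  proof (rule absolutely_integrable_spike[OF _ neg])
    show "G absolutely_integrable_on C" using has_weak_gradientD(3)[OF G that] .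
  qed (use that in auto)
  have "(LINT x|lebesgue_on \<Omega>. \<phi> x *\<^sub>R G x) = (LINT x|lebesgue_on \<Omega>. \<phi> x *\<^sub>R H x)" if t: "C1c_test \<Omega> \<phi> g" for \<phi> g
  proof (rule integral_cong_AE)
    show "(\<lambda>x. \<phi> x *\<^sub>R G x) \<in> borel_measurable (lebesgue_on \<Omega>)"
      by (intro borel_measurable_integrable integrable_test_scaleR[OF \<open>open \<Omega>\<close> t]
        has_weak_gradientD(3)[OF G])
    show "(\<lambda>x. \<phi> x *\<^sub>R H x) \<in> borel_measurable (lebesgue_on \<Omega>)"
      by (intro borel_measurable_integrable integrable_test_scaleR[OF \<open>open \<Omega>\<close> t] H)
    show "AE x in lebesgue_on \<Omega>. \<phi> x *\<^sub>R G x = \<phi> x *\<^sub>R H x" using ae by eventually_elim simp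
  qed
  then show ?thesis
    using has_weak_gradientD(1,2)[OF G] H by (simp add: has_weak_gradient_def)
qed

section \<open>Closedness of the constraint set under uniform limits\<close>

text \<open>A substitute for weak compactness. In a decreasing sequence of midpoint-convex sets of
  functions bounded by 1, the infima \<open>d n\<close> of the squared \<open>L\<^sup>2\<close> norm increase to a limit \<open>L\<close>. If
  \<open>F n\<close> nearly attains \<open>d n\<close>, the midpoint of two late members still has norm at least \<open>d N\<close>, and
  the parallelogram identity forces the sequence to be Cauchy in \<open>L\<^sup>2\<close>. On a finite
  measure space it is then Cauchy in \<open>L\<^sup>1\<close>, and a subsequence is Cauchy almost everywhere.\<close>

lemma AE_Cauchy_selection:
  fixes A :: "nat \<Rightarrow> ('a \<Rightarrow> 'b::euclidean_space) set"
  assumes "finite_measure M"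
    and dec: "\<And>m n. m \<le> n \<Longrightarrow> A n \<subseteq> A m"
    and ne: "\<And>n. A n \<noteq> {}"
    and mid: "\<And>n F G. F \<in> A n \<Longrightarrow> G \<in> A n \<Longrightarrow> (\<lambda>x. (1/2) *\<^sub>R (F x + G x)) \<in> A n"
    and meas: "\<And>n F. F \<in> A n \<Longrightarrow> F \<in> borel_measurable M"
    and le1: "\<And>n F x. F \<in> A n \<Longrightarrow> x \<in> space M \<Longrightarrow> norm (F x) \<le> 1"
  obtains F r where "\<And>n. F n \<in> A n" "strict_mono r" "AE x in M. Cauchy (\<lambda>n. F (r n) x)"
proof -
  interpret finite_measure M by fact
  define E where "E F = (LINT x|M. (norm (F x))\<^sup>2)" for F :: "'a \<Rightarrow> 'b"
  define m where "m = measure M (space M)"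
  define e where "e n = 1 / real (Suc n)" for n
  define d where "d n = Inf (E ` A n)" for n
  have e0: "e \<longlonglongrightarrow> 0" unfolding e_def[abs_def] by real_asymp
  have epos: "0 < e n" for n by (simp add: e_def)
  have edec: "e n \<le> e k" if "k \<le> n" for k n using that by (simp add: e_def frac_le)
  have sq: "(norm (F x))\<^sup>2 \<le> 1" if "F \<in> A n" "x \<in> space M" for F n x
    using le1[OF that] by (simp add: power_le_one)
  have intsq: "integrable M (\<lambda>x. (norm (F x))\<^sup>2)" if "F \<in> A n" for F n
    by (rule integrable_const_bound[where B = 1])
       (use meas[OF that] sq[OF that] in \<open>auto intro!: AE_I2\<close>)
  have E0: "0 \<le> E F" for F unfolding E_def by simp
  have Em: "E F \<le> m" if "F \<in> A n" for F n
  proof -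
    have "E F \<le> (LINT x|M. 1)"
      unfolding E_def by (rule integral_mono[OF intsq[OF that]]) (use sq[OF that] in auto)
    then show ?thesis by (simp add: m_def)
  qed
  have bdd: "bdd_below (E ` A n)" for n by (rule bdd_belowI2[where m = 0]) (rule E0)
  have d_le: "d n \<le> E F" if "F \<in> A n" for n F
    unfolding d_def by (intro cINF_lower bdd that)
  have "incseq d"
    unfolding incseq_def d_def
    by (intro allI impI cINF_superset_mono ne bdd dec order_refl)
  moreover have "d n \<le> m" for n using ne[of n] d_le Em by (meson all_not_in_conv order_trans)
  ultimately obtain L where L: "d \<longlonglongrightarrow> L" "\<And>n. d n \<le> L"
    using incseq_convergent by blast
  have "\<exists>F\<in>A n. E F < d n + e n" for n
    using cINF_less_iff[OF ne[of n] bdd[of n], of "d n + e n"] epos[of n] unfolding d_def by auto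
  then obtain F where F: "\<And>n. F n \<in> A n" "\<And>n. E (F n) < d n + e n" by metis
  have par: "(LINT x|M. (norm (F i x - F j x))\<^sup>2) \<le> 4 * (L - d N) + 4 * e N" if "N \<le> i" "N \<le> j" for N i j
  proof -
    define H where "H x = (1/2) *\<^sub>R (F i x + F j x)" for x
    have FN: "F i \<in> A N" "F j \<in> A N" using F(1) dec that by blast+
    then have H: "H \<in> A N" unfolding H_def[abs_def] by (rule mid)
    have eq: "(norm (F i x - F j x))\<^sup>2 = 2 * (norm (F i x))\<^sup>2 + 2 * (norm (F j x))\<^sup>2 - 4 * (norm (H x))\<^sup>2" for x
      by (simp add: H_def power2_norm_eq_inner inner_add_left inner_add_right inner_diff_left
          inner_diff_right inner_commute field_simps)
    have "(LINT x|M. (norm (F i x - F j x))\<^sup>2) = 2 * E (F i) + 2 * E (F j) - 4 * E H"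
      unfolding eq E_def using intsq[OF FN(1)] intsq[OF FN(2)] intsq[OF H] by simp
    also have "\<dots> \<le> 4 * (L - d N) + 4 * e N"
      using d_le[OF H] F(2)[of i] F(2)[of j] L(2)[of i] L(2)[of j] edec[OF that(1)] edec[OF that(2)]
      by (simp add: algebra_simps)
    finally show ?thesis .
  qed
  have int1: "integrable M (F n)" for n
    by (rule integrable_const_bound[where B = 1])
       (use meas[OF F(1)] le1[OF F(1)] in \<open>auto intro!: AE_I2\<close>)
  have "\<exists>N. \<forall>i\<ge>N. \<forall>j\<ge>N. (LINT x|M. norm (F i x - F j x)) < \<epsilon>" if "\<epsilon> > 0" for \<epsilon>
  proof -
    \<comment> \<open>the L1 norm is controlled by the L2 norm through s <= delta + s^2 / delta\<close>
    define \<delta> where "\<delta> = \<epsilon> / (2 * (m + 1))"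
    have "m \<ge> 0" by (simp add: m_def)
    then have \<delta>: "\<delta> > 0" "\<delta> * m < \<epsilon> / 2" using that by (auto simp: \<delta>_def field_simps)
    have "(\<lambda>N. (4 * (L - d N) + 4 * e N) / \<delta>) \<longlonglongrightarrow> (4 * (L - L) + 4 * 0) / \<delta>"
      using \<delta>(1) by (intro tendsto_intros L(1) e0) auto
    then have "\<forall>\<^sub>F N in sequentially. (4 * (L - d N) + 4 * e N) / \<delta> < \<epsilon> / 2"
      using that by (intro order_tendstoD(2)) auto
    then obtain N where N: "(4 * (L - d N) + 4 * e N) / \<delta> < \<epsilon> / 2"
      by (auto simp: eventually_sequentially)
    have "(LINT x|M. norm (F i x - F j x)) < \<epsilon>" if ij: "N \<le> i" "N \<le> j" for i j
    proof -
      have int2: "integrable M (\<lambda>x. (norm (F i x - F j x))\<^sup>2)"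
      proof (rule integrable_const_bound[where B = "2\<^sup>2"])
        show "AE x in M. norm ((norm (F i x - F j x))\<^sup>2) \<le> 2\<^sup>2"
        proof (rule AE_I2)
          fix x assume x: "x \<in> space M"
          have "norm (F i x - F j x) \<le> 2"
            using norm_triangle_ineq4[of "F i x" "F j x"] le1[OF F(1) x, of i] le1[OF F(1) x, of j] by linarith
          from power_mono[OF this norm_ge_zero, of 2]
          show "norm ((norm (F i x - F j x))\<^sup>2) \<le> 2\<^sup>2" by simp
        qed
        show "(\<lambda>x. (norm (F i x - F j x))\<^sup>2) \<in> borel_measurable M"
          using meas[OF F(1)[of i]] meas[OF F(1)[of j]] by measurable
      qed
      have "(LINT x|M. norm (F i x - F j x)) \<le> (LINT x|M. \<delta> + (norm (F i x - F j x))\<^sup>2 / \<delta>)"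
      proof (rule integral_mono)
        fix x
        define s where "s = norm (F i x - F j x)"
        have "2 * (s * \<delta>) \<le> \<delta>\<^sup>2 + s\<^sup>2"
          using zero_le_power2[of "s - \<delta>"] by (simp add: power2_diff)
        moreover have "0 \<le> s * \<delta>" using \<delta>(1) by (simp add: s_def)
        ultimately have "s * \<delta> \<le> \<delta>\<^sup>2 + s\<^sup>2" by linarith
        then have "s * \<delta> / \<delta> \<le> (\<delta>\<^sup>2 + s\<^sup>2) / \<delta>"
          using \<delta>(1) by (intro divide_right_mono) auto
        then have "s \<le> \<delta> + s\<^sup>2 / \<delta>"
          using \<delta>(1) by (simp add: add_divide_distrib power2_eq_square)
        then show "norm (F i x - F j x) \<le> \<delta> + (norm (F i x - F j x))\<^sup>2 / \<delta>"
          by (simp add: s_def)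
      qed (use int1 int2 in auto)
      also have "\<dots> = \<delta> * m + (LINT x|M. (norm (F i x - F j x))\<^sup>2) / \<delta>"
        using int2 by (simp add: m_def mult.commute)
      also have "\<dots> \<le> \<delta> * m + (4 * (L - d N) + 4 * e N) / \<delta>"
        using par[OF ij] \<delta>(1) by (simp add: divide_right_mono)
      finally show ?thesis using \<delta>(2) N by linarith
    qed
    then show ?thesis by blast
  qed
  note L1_Cauchy = this
  obtain r where r: "strict_mono r" "AE x in M. Cauchy (\<lambda>i. F (r i) x)"
    by (rule cauchy_L1_AE_cauchy_subseq[OF int1 L1_Cauchy]) (auto intro: that)
  show thesis by (rule that[OF F(1) r])
qed

text \<open>The bound is required at every point, and not just almost everywhere, so that these gradients
  satisfy the pointwise hypothesis of the selection lemma.\<close>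

definition unit_gradient :: "'a::euclidean_space set \<Rightarrow> ('a \<Rightarrow> real) \<Rightarrow> ('a \<Rightarrow> 'a) \<Rightarrow> bool" where
  "unit_gradient \<Omega> u G \<longleftrightarrow> has_weak_gradient \<Omega> u G \<and>
     G \<in> borel_measurable (lebesgue_on \<Omega>) \<and> (\<forall>x\<in>\<Omega>. norm (G x) \<le> 1)"

lemma borel_measurable_lebesgue_on_AE:
  fixes G H :: "'a::euclidean_space \<Rightarrow> 'b::euclidean_space"
  assumes "S \<in> sets lebesgue" "G \<in> borel_measurable (lebesgue_on S)" "AE x in lebesgue_on S. G x = H x"
  shows "H \<in> borel_measurable (lebesgue_on S)"
proof -
  have "(\<lambda>x. indicator S x *\<^sub>R H x) \<in> borel_measurable lebesgue"
  proof (rule borel_measurable_AE)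
    show "(\<lambda>x. indicator S x *\<^sub>R G x) \<in> borel_measurable lebesgue"
      using assms(1,2) by (simp add: borel_measurable_restrict_space_iff)
    have "AE x in lebesgue. x \<in> S \<longrightarrow> G x = H x"
      using assms(1,3) by (simp add: AE_restrict_space_iff)
    then show "AE x in lebesgue. indicator S x *\<^sub>R G x = indicator S x *\<^sub>R H x"
      by eventually_elim (auto simp: indicator_def)
  qed
  then show ?thesis using assms(1) by (simp add: borel_measurable_restrict_space_iff)
qed

lemma Cbar_measurable_bounded:
  assumes "open \<Omega>" "bounded \<Omega>" "u \<in> Cbar \<Omega>"
  shows "u \<in> borel_measurable (lebesgue_on \<Omega>)"
    and "\<exists>B. \<forall>x\<in>closure \<Omega>. \<bar>u x\<bar> \<le> B"
proof -
  have u: "continuous_on (closure \<Omega>) u" using assms(3) by (simp add: Cbar_def)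
  have "\<Omega> \<in> sets lebesgue" using assms(1) by auto
  then show "u \<in> borel_measurable (lebesgue_on \<Omega>)"
    by (rule continuous_imp_measurable_on_sets_lebesgue[OF continuous_on_subset[OF u closure_subset]])
  have "compact (closure \<Omega>)" using assms(2) by (simp add: compact_closure)
  from compact_imp_bounded[OF compact_continuous_image[OF u this]]
  show "\<exists>B. \<forall>x\<in>closure \<Omega>. \<bar>u x\<bar> \<le> B" unfolding bounded_iff by auto
qed

lemma in_LinfI:
  fixes f :: "'a::euclidean_space \<Rightarrow> 'b::euclidean_space"
  assumes "f \<in> borel_measurable (lebesgue_on S)" "\<And>x. x \<in> S \<Longrightarrow> norm (f x) \<le> B"
  shows "f \<in> Linf S"
proof -
  have "Linf_norm S f \<le> ereal B"
    unfolding Linf_norm_def by (rule esssup_I) (use assms in \<open>auto intro!: AE_I2\<close>)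
  then have "Linf_norm S f < \<infinity>" by (rule le_less_trans) simp
  then show ?thesis using assms(1) by (simp add: Linf_def)
qed

lemma in_K_setI:
  assumes \<Omega>: "open \<Omega>" "bounded \<Omega>" and u: "u \<in> Cbar \<Omega>" and G: "unit_gradient \<Omega> u G"
  shows "u \<in> K_set \<Omega>"
proof -
  have G: "has_weak_gradient \<Omega> u G" "G \<in> borel_measurable (lebesgue_on \<Omega>)" "\<And>x. x \<in> \<Omega> \<Longrightarrow> norm (G x) \<le> 1"
    using G by (auto simp: unit_gradient_def)
  obtain B where "\<And>x. x \<in> closure \<Omega> \<Longrightarrow> \<bar>u x\<bar> \<le> B" using Cbar_measurable_bounded(2)[OF \<Omega> u] by blast
  then have "u \<in> Linf \<Omega>"
    using closure_subset[of \<Omega>] by (intro in_LinfI[OF Cbar_measurable_bounded(1)[OF \<Omega> u]]) auto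
  moreover have "G \<in> Linf \<Omega>" by (rule in_LinfI[OF G(2,3)])
  ultimately have W: "u \<in> W1inf \<Omega>" using u G(1) by (auto simp: W1inf_def)
  have "has_weak_gradient \<Omega> u (wgrad \<Omega> u)" unfolding wgrad_def by (rule someI[of _ G]) (rule G(1))
  then have ae: "AE x in lebesgue_on \<Omega>. G x = wgrad \<Omega> u x"
    using has_weak_gradient_unique[OF \<Omega>(1) G(1)] by blast
  have "wgrad \<Omega> u \<in> borel_measurable (lebesgue_on \<Omega>)"
    by (rule borel_measurable_lebesgue_on_AE[OF _ G(2) ae]) (use \<Omega>(1) in auto)
  moreover have "AE x in lebesgue_on \<Omega>. norm (wgrad \<Omega> u x) \<le> 1"
    using ae AE_space
  proof eventually_elim
    case (elim x)
    then show ?case using G(3)[of x] by simp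
  qed
  ultimately have "Linf_norm \<Omega> (wgrad \<Omega> u) \<le> 1"
    unfolding Linf_norm_def by (intro esssup_I) auto
  with W show ?thesis by (simp add: K_set_def)
qed

lemma AE_norm_le_Linf_norm:
  "AE x in lebesgue_on S. ereal (norm (f x)) \<le> Linf_norm S f"
  unfolding Linf_norm_def by (rule esssup_AE)

text \<open>Resetting the gradient to zero where its norm exceeds 1 changes it on a null set only.\<close>

lemma unit_gradient_if_AE_norm_le_1:
  assumes "open \<Omega>" and H: "has_weak_gradient \<Omega> u H" "H \<in> borel_measurable (lebesgue_on \<Omega>)"
    and le: "AE x in lebesgue_on \<Omega>. norm (H x) \<le> 1"
  obtains G where "unit_gradient \<Omega> u G" "AE x in lebesgue_on \<Omega>. H x = G x"
proof -
  define G where "G x = (if norm (H x) \<le> 1 then H x else 0)" for x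
  have [measurable]: "H \<in> borel_measurable (lebesgue_on \<Omega>)" by (rule H(2))
  have Gm: "G \<in> borel_measurable (lebesgue_on \<Omega>)" unfolding G_def[abs_def] by measurable
  have ae: "AE x in lebesgue_on \<Omega>. H x = G x"
    using le by eventually_elim (simp add: G_def)
  have "has_weak_gradient \<Omega> u G" by (rule has_weak_gradient_cong_AE[OF assms(1) H(1) ae])
  then have "unit_gradient \<Omega> u G" using Gm by (simp add: unit_gradient_def G_def)
  then show thesis using ae by (rule that)
qed

lemma in_K_setE:
  assumes \<Omega>: "open \<Omega>" and u: "u \<in> K_set \<Omega>"
  obtains G where "u \<in> Cbar \<Omega>" "unit_gradient \<Omega> u G" "AE x in lebesgue_on \<Omega>. wgrad \<Omega> u x = G x"
proof -
  from u obtain H where H: "has_weak_gradient \<Omega> u H" "H \<in> borel_measurable (lebesgue_on \<Omega>)"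
    and uC: "u \<in> Cbar \<Omega>" and le: "Linf_norm \<Omega> (wgrad \<Omega> u) \<le> 1"
    by (auto simp: K_set_def W1inf_def Linf_def)
  have w: "has_weak_gradient \<Omega> u (wgrad \<Omega> u)" unfolding wgrad_def by (rule someI[of _ H]) (rule H(1))
  have ae: "AE x in lebesgue_on \<Omega>. H x = wgrad \<Omega> u x"
    by (rule has_weak_gradient_unique[OF \<Omega> H(1) w])
  have wm: "wgrad \<Omega> u \<in> borel_measurable (lebesgue_on \<Omega>)"
    by (rule borel_measurable_lebesgue_on_AE[OF _ H(2) ae]) (use \<Omega> in auto)
  have "AE x in lebesgue_on \<Omega>. norm (wgrad \<Omega> u x) \<le> 1"
    using AE_norm_le_Linf_norm[where S = \<Omega> and f = "wgrad \<Omega> u"]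
  proof eventually_elim
    case (elim x)
    then have "ereal (norm (wgrad \<Omega> u x)) \<le> 1" using le by (rule order_trans)
    then show ?case by simp
  qed
  from unit_gradient_if_AE_norm_le_1[OF \<Omega> w wm this] that[OF uC] show thesis by blast
qed

lemma has_weak_gradient_lincomb:
  assumes "open \<Omega>" and G: "has_weak_gradient \<Omega> u G" and H: "has_weak_gradient \<Omega> v H"
  shows "has_weak_gradient \<Omega> (\<lambda>x. c * u x + d * v x) (\<lambda>x. c *\<^sub>R G x + d *\<^sub>R H x)"
  unfolding has_weak_gradient_def
proof (intro conjI allI impI)
  fix C assume C: "compact C \<and> C \<subseteq> \<Omega>"
  then have C': "compact C" "C \<subseteq> \<Omega>" by auto
  show "(\<lambda>x. c * u x + d * v x) absolutely_integrable_on C"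
    by (intro set_integral_add set_integrable_mult_right impI has_weak_gradientD(1)[OF G C'] has_weak_gradientD(1)[OF H C'])
  show "(\<lambda>x. c *\<^sub>R G x + d *\<^sub>R H x) absolutely_integrable_on C"
    by (intro set_integral_add absolutely_integrable_scaleR_left has_weak_gradientD(3)[OF G C'] has_weak_gradientD(3)[OF H C'])
next
  fix \<phi> g assume t: "C1c_test \<Omega> \<phi> g"
  note i1 = integrable_test_scaleR[OF \<open>open \<Omega>\<close> t has_weak_gradientD(3)[OF G]]
    integrable_test_scaleR[OF \<open>open \<Omega>\<close> t has_weak_gradientD(3)[OF H]]
    integrable_scaleR_test_gradient[OF \<open>open \<Omega>\<close> t has_weak_gradientD(1)[OF G]]
    integrable_scaleR_test_gradient[OF \<open>open \<Omega>\<close> t has_weak_gradientD(1)[OF H]]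
  have "(LINT x|lebesgue_on \<Omega>. (c * u x + d * v x) *\<^sub>R g x)
      = (LINT x|lebesgue_on \<Omega>. c *\<^sub>R (u x *\<^sub>R g x) + d *\<^sub>R (v x *\<^sub>R g x))"
    by (simp add: scaleR_add_left)
  also have "\<dots> = c *\<^sub>R (LINT x|lebesgue_on \<Omega>. u x *\<^sub>R g x) + d *\<^sub>R (LINT x|lebesgue_on \<Omega>. v x *\<^sub>R g x)"
    using i1 by (simp del: scaleR_scaleR)
  also have "\<dots> = - (c *\<^sub>R (LINT x|lebesgue_on \<Omega>. \<phi> x *\<^sub>R G x) + d *\<^sub>R (LINT x|lebesgue_on \<Omega>. \<phi> x *\<^sub>R H x))"
    unfolding has_weak_gradientD(2)[OF G t] has_weak_gradientD(2)[OF H t] by simp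
  also have "\<dots> = - (LINT x|lebesgue_on \<Omega>. c *\<^sub>R (\<phi> x *\<^sub>R G x) + d *\<^sub>R (\<phi> x *\<^sub>R H x))"
    using i1 by (simp del: scaleR_scaleR)
  also have "\<dots> = - (LINT x|lebesgue_on \<Omega>. \<phi> x *\<^sub>R (c *\<^sub>R G x + d *\<^sub>R H x))"
    by (simp add: scaleR_add_right mult.commute)
  finally show "(LINT x|lebesgue_on \<Omega>. (c * u x + d * v x) *\<^sub>R g x) =
      - (LINT x|lebesgue_on \<Omega>. \<phi> x *\<^sub>R (c *\<^sub>R G x + d *\<^sub>R H x))" .
qed

lemma finite_measure_bounded_open:
  "open \<Omega> \<Longrightarrow> bounded \<Omega> \<Longrightarrow> finite_measure (lebesgue_on (\<Omega>::'a::euclidean_space set))"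
  by (intro finite_measure_lebesgue_on lmeasurable_open)

text \<open>Uniform convergence says nothing about convergence of gradients, so they are chosen anew: for each
  \<open>n\<close> take the set of gradients of all functions with gradient at most 1 whose distance from the limit
  function is at most \<open>1 / (n + 1)\<close>. These sets are nonempty, midpoint-convex and decreasing. The
  selection lemma yields gradients that converge almost everywhere, and the weak identity passes to
  the limit by dominated convergence.\<close>

theorem K_set_uniform_limit:
  fixes \<Omega> :: "'a::euclidean_space set"
  assumes \<Omega>: "open \<Omega>" "bounded \<Omega>" and v: "\<And>n. v n \<in> K_set \<Omega>"
    and lim: "uniform_limit (closure \<Omega>) v u sequentially"
  shows "u \<in> K_set \<Omega>"
proof -
  interpret finite_measure "lebesgue_on \<Omega>" by (rule finite_measure_bounded_open[OF \<Omega>])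
  have \<Omega>m: "\<Omega> \<in> sets lebesgue" using \<Omega>(1) by auto
  have "continuous_on (closure \<Omega>) (v n)" for n
    using v by (simp add: K_set_def W1inf_def Cbar_def)
  then have uC: "u \<in> Cbar \<Omega>"
    unfolding Cbar_def mem_Collect_eq
    by (intro uniform_limit_theorem[OF _ lim]) auto
  obtain Bu where Bu: "\<And>x. x \<in> closure \<Omega> \<Longrightarrow> \<bar>u x\<bar> \<le> Bu" using Cbar_measurable_bounded(2)[OF \<Omega> uC] by blast
  define e where "e n = 1 / real (Suc n)" for n
  have e: "e \<longlonglongrightarrow> 0" "\<And>n. 0 < e n" "\<And>n. e n \<le> 1" unfolding e_def[abs_def] by (real_asymp, auto)
  define A where "A n = {G. \<exists>w\<in>Cbar \<Omega>. unit_gradient \<Omega> w G \<and> (\<forall>x\<in>\<Omega>. \<bar>w x - u x\<bar> \<le> e n)}" for n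
  obtain F r where F: "\<And>n. F n \<in> A n" and r: "strict_mono r"
    and cau: "AE x in lebesgue_on \<Omega>. Cauchy (\<lambda>n. F (r n) x)"
  proof (rule AE_Cauchy_selection[of "lebesgue_on \<Omega>" A])
    show "finite_measure (lebesgue_on \<Omega>)" by unfold_locales
    show "A n \<subseteq> A m" if "m \<le> n" for m n
    proof -
      have "e n \<le> e m" using that by (simp add: e_def frac_le)
      then show ?thesis unfolding A_def by (blast intro: order_trans)
    qed
    show "A n \<noteq> {}" for n
    proof -
      from uniform_limitD[OF lim e(2)[of n]]
      obtain k where k: "\<And>x. x \<in> closure \<Omega> \<Longrightarrow> dist (v k x) (u x) < e n"
        by (auto simp: eventually_sequentially)
      obtain G where G: "v k \<in> Cbar \<Omega>" "unit_gradient \<Omega> (v k) G" using in_K_setE[OF \<Omega>(1) v] by metis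
      have "\<bar>v k x - u x\<bar> \<le> e n" if "x \<in> \<Omega>" for x
        using k[OF subsetD[OF closure_subset that]] by (simp add: dist_real_def)
      then have "G \<in> A n" unfolding A_def using G by blast
      then show ?thesis by blast
    qed
    show "(\<lambda>x. (1/2) *\<^sub>R (G x + H x)) \<in> A n" if "G \<in> A n" "H \<in> A n" for n G H
    proof -
      obtain w z where w: "w \<in> Cbar \<Omega>" "unit_gradient \<Omega> w G" "\<And>x. x \<in> \<Omega> \<Longrightarrow> \<bar>w x - u x\<bar> \<le> e n"
        and z: "z \<in> Cbar \<Omega>" "unit_gradient \<Omega> z H" "\<And>x. x \<in> \<Omega> \<Longrightarrow> \<bar>z x - u x\<bar> \<le> e n"
        using \<open>G \<in> A n\<close> \<open>H \<in> A n\<close> unfolding A_def by blast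
      define y where "y x = 1/2 * w x + 1/2 * z x" for x
      have [measurable]: "G \<in> borel_measurable (lebesgue_on \<Omega>)" "H \<in> borel_measurable (lebesgue_on \<Omega>)"
        using w(2) z(2) by (auto simp: unit_gradient_def)
      have "y \<in> Cbar \<Omega>"
        using w(1) z(1) unfolding Cbar_def y_def[abs_def] by (auto intro!: continuous_intros)
      moreover have "\<bar>y x - u x\<bar> \<le> e n" if "x \<in> \<Omega>" for x
        using w(3)[OF that] z(3)[OF that] by (simp add: y_def abs_le_iff)
      moreover have "has_weak_gradient \<Omega> y (\<lambda>x. (1/2) *\<^sub>R G x + (1/2) *\<^sub>R H x)"
        unfolding y_def[abs_def] using w(2) z(2)
        by (intro has_weak_gradient_lincomb[OF \<Omega>(1)]) (auto simp: unit_gradient_def)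
      moreover have "norm ((1/2) *\<^sub>R (G x + H x)) \<le> 1" if "x \<in> \<Omega>" for x
      proof -
        have "norm (G x) \<le> 1" "norm (H x) \<le> 1" using w(2) z(2) that by (auto simp: unit_gradient_def)
        then show ?thesis using norm_triangle_ineq[of "G x" "H x"] by simp
      qed
      ultimately have "unit_gradient \<Omega> y (\<lambda>x. (1/2) *\<^sub>R (G x + H x))"
        unfolding unit_gradient_def by (auto simp: scaleR_add_right)
      then show ?thesis unfolding A_def
        using \<open>y \<in> Cbar \<Omega>\<close> \<open>\<And>x. x \<in> \<Omega> \<Longrightarrow> \<bar>y x - u x\<bar> \<le> e n\<close> by blast
    qed
    show "G \<in> borel_measurable (lebesgue_on \<Omega>)" if "G \<in> A n" for n G
      using that by (auto simp: A_def unit_gradient_def)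
    show "norm (G x) \<le> 1" if "G \<in> A n" "x \<in> space (lebesgue_on \<Omega>)" for n G x
      using that by (auto simp: A_def unit_gradient_def)
  qed (rule that)
  have "\<exists>w\<in>Cbar \<Omega>. unit_gradient \<Omega> w (F n) \<and> (\<forall>x\<in>\<Omega>. \<bar>w x - u x\<bar> \<le> e n)" for n
    using F[of n] by (simp add: A_def)
  then obtain w where wC: "\<And>n. w n \<in> Cbar \<Omega>" and wF: "\<And>n. unit_gradient \<Omega> (w n) (F n)"
    and we: "\<And>n x. x \<in> \<Omega> \<Longrightarrow> \<bar>w n x - u x\<bar> \<le> e n" by metis
  have Fm [measurable]: "F n \<in> borel_measurable (lebesgue_on \<Omega>)" for n
    using wF by (simp add: unit_gradient_def)
  have F1: "norm (F n x) \<le> 1" if "x \<in> \<Omega>" for n x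
    using wF that by (simp add: unit_gradient_def)
  define G0 where "G0 x = lim (\<lambda>n. F (r n) x)" for x
  define G where "G x = (if norm (G0 x) \<le> 1 then G0 x else 0)" for x
  have [measurable]: "G0 \<in> borel_measurable (lebesgue_on \<Omega>)"
    unfolding G0_def[abs_def] by (rule borel_measurable_lim_metric) simp
  have Gm [measurable]: "G \<in> borel_measurable (lebesgue_on \<Omega>)" unfolding G_def[abs_def] by measurable
  have G1: "norm (G x) \<le> 1" for x by (simp add: G_def)
  have FG: "AE x in lebesgue_on \<Omega>. (\<lambda>n. F (r n) x) \<longlonglongrightarrow> G x"
    using cau AE_space
  proof eventually_elim
    case (elim x)
    then have l: "(\<lambda>n. F (r n) x) \<longlonglongrightarrow> G0 x"
      unfolding G0_def by (simp add: Cauchy_convergent_iff convergent_LIMSEQ_iff)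
    have "norm (G0 x) \<le> 1"
      by (rule LIMSEQ_le_const2[OF tendsto_norm[OF l]]) (use F1 elim in auto)
    then show ?case using l by (simp add: G_def)
  qed
  have er: "(\<lambda>n. e (r n)) \<longlonglongrightarrow> 0" using LIMSEQ_subseq_LIMSEQ[OF e(1) r] by (simp add: o_def)
  have wu: "(\<lambda>n. w (r n) x) \<longlonglongrightarrow> u x" if "x \<in> \<Omega>" for x
  proof -
    have "(\<lambda>n. w (r n) x - u x) \<longlonglongrightarrow> 0"
      by (rule Lim_null_comparison[OF _ er]) (use we[OF that] in auto)
    then show ?thesis by (simp add: LIM_zero_iff)
  qed
  have "has_weak_gradient \<Omega> u G"
    unfolding has_weak_gradient_def
  proof (intro conjI allI impI)
    fix C assume "compact C \<and> C \<subseteq> \<Omega>"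
    then have C: "compact C" "C \<subseteq> \<Omega>" by auto
    have "continuous_on C u"
      using uC C(2) closure_subset[of \<Omega>] unfolding Cbar_def by (auto intro: continuous_on_subset)
    then show "u absolutely_integrable_on C" by (rule absolutely_integrable_on_compact_continuous[OF C(1)])
    have Cm: "C \<in> lmeasurable" "C \<in> sets lebesgue"
      using C(1) by (auto intro: lmeasurable_compact fmeasurableD)
    show "G absolutely_integrable_on C"
      by (rule measurable_bounded_by_integrable_imp_absolutely_integrable
        [OF measurable_restrict_mono[OF Gm C(2)] Cm(2) integrable_on_const[OF Cm(1)] G1])
  next
    fix \<phi> g assume t: "C1c_test \<Omega> \<phi> g"
    obtain B where B: "0 \<le> B" "\<And>x. \<bar>\<phi> x\<bar> \<le> B" "\<And>x. norm (g x) \<le> B"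
      using C1c_test_E[OF t] by metis
    have "\<phi> \<in> borel_measurable borel" "g \<in> borel_measurable borel"
      using C1c_test_continuous[OF t] by (auto intro: borel_measurable_continuous_onI)
    then have [measurable]: "\<phi> \<in> borel_measurable (lebesgue_on \<Omega>)" "g \<in> borel_measurable (lebesgue_on \<Omega>)"
      by (simp_all add: measurable_restrict_space1 measurable_completion)
    note [measurable] = Cbar_measurable_bounded(1)[OF \<Omega> wC] Cbar_measurable_bounded(1)[OF \<Omega> uC]
    have l1: "(\<lambda>n. LINT x|lebesgue_on \<Omega>. w (r n) x *\<^sub>R g x) \<longlonglongrightarrow> (LINT x|lebesgue_on \<Omega>. u x *\<^sub>R g x)"
    proof (rule integral_dominated_convergence[where w = "\<lambda>_. (Bu + 1) * B"])
      show "AE x in lebesgue_on \<Omega>. (\<lambda>n. w (r n) x *\<^sub>R g x) \<longlonglongrightarrow> u x *\<^sub>R g x"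
        by (rule AE_I2) (auto intro!: tendsto_intros wu)
      show "AE x in lebesgue_on \<Omega>. norm (w (r n) x *\<^sub>R g x) \<le> (Bu + 1) * B" for n
      proof (rule AE_I2)
        fix x assume "x \<in> space (lebesgue_on \<Omega>)"
        then have x: "x \<in> \<Omega>" by simp
        have "\<bar>w (r n) x\<bar> \<le> Bu + 1"
          using we[OF x, of "r n"] e(3)[of "r n"] Bu[OF subsetD[OF closure_subset x]] by linarith
        then show "norm (w (r n) x *\<^sub>R g x) \<le> (Bu + 1) * B"
          using B(3)[of x] by (simp, intro mult_mono) auto
      qed
    qed auto
    have l2: "(\<lambda>n. LINT x|lebesgue_on \<Omega>. \<phi> x *\<^sub>R F (r n) x) \<longlonglongrightarrow> (LINT x|lebesgue_on \<Omega>. \<phi> x *\<^sub>R G x)"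
    proof (rule integral_dominated_convergence[where w = "\<lambda>_. B * 1"])
      show "AE x in lebesgue_on \<Omega>. (\<lambda>n. \<phi> x *\<^sub>R F (r n) x) \<longlonglongrightarrow> \<phi> x *\<^sub>R G x"
        using FG by eventually_elim (intro tendsto_intros)
      show "AE x in lebesgue_on \<Omega>. norm (\<phi> x *\<^sub>R F (r n) x) \<le> B * 1" for n
      proof (rule AE_I2)
        fix x assume "x \<in> space (lebesgue_on \<Omega>)"
        then have "norm (F (r n) x) \<le> 1" using F1 by simp
        then show "norm (\<phi> x *\<^sub>R F (r n) x) \<le> B * 1"
          unfolding norm_scaleR using B(1,2) by (intro mult_mono) auto
      qed
    qed auto
    have "(LINT x|lebesgue_on \<Omega>. w (r n) x *\<^sub>R g x) = - (LINT x|lebesgue_on \<Omega>. \<phi> x *\<^sub>R F (r n) x)" for n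
      using wF[of "r n"] has_weak_gradientD(2)[OF _ t] by (simp add: unit_gradient_def)
    then have "(\<lambda>n. - (LINT x|lebesgue_on \<Omega>. \<phi> x *\<^sub>R F (r n) x)) \<longlonglongrightarrow> (LINT x|lebesgue_on \<Omega>. u x *\<^sub>R g x)"
      using l1 by simp
    from LIMSEQ_unique[OF this tendsto_minus[OF l2]]
    show "(LINT x|lebesgue_on \<Omega>. u x *\<^sub>R g x) = - (LINT x|lebesgue_on \<Omega>. \<phi> x *\<^sub>R G x)" .
  qed
  then have "unit_gradient \<Omega> u G" using Gm G1 by (simp add: unit_gradient_def)
  then show ?thesis by (rule in_K_setI[OF \<Omega> uC])
qed

section \<open>Weighted integrals and their first variation\<close>

lemma Linf_AE_bound:
  assumes "f \<in> Linf S"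
  obtains B where "0 \<le> B" "AE x in lebesgue_on S. norm (f x) \<le> B"
proof -
  have "Linf_norm S f < \<infinity>" using assms by (simp add: Linf_def)
  then obtain B where B: "Linf_norm S f \<le> ereal B"
    by (cases "Linf_norm S f") (auto intro: that)
  have "AE x in lebesgue_on S. norm (f x) \<le> max 0 B"
    using AE_norm_le_Linf_norm[where S = S and f = f]
  proof eventually_elim
    case (elim x)
    then have "ereal (norm (f x)) \<le> ereal B" using B by (rule order_trans)
    then show ?case by simp
  qed
  then show thesis by (rule that[rotated]) simp
qed

lemma integrable_weighted:
  fixes a h :: "'a::euclidean_space \<Rightarrow> real"
  assumes \<Omega>: "open \<Omega>" "bounded \<Omega>" and a: "a \<in> Linf \<Omega>"
    and h: "h \<in> borel_measurable (lebesgue_on \<Omega>)" "\<And>x. x \<in> \<Omega> \<Longrightarrow> \<bar>h x\<bar> \<le> B"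
  shows "integrable (lebesgue_on \<Omega>) (\<lambda>x. a x * h x)"
proof -
  interpret finite_measure "lebesgue_on \<Omega>" by (rule finite_measure_bounded_open[OF \<Omega>])
  obtain A where A: "0 \<le> A" "AE x in lebesgue_on \<Omega>. norm (a x) \<le> A" using Linf_AE_bound[OF a] by blast
  have "AE x in lebesgue_on \<Omega>. norm (a x * h x) \<le> A * B"
    using A(2) AE_space
  proof eventually_elim
    case (elim x)
    then show ?case using h(2)[of x] A(1) by (auto simp: abs_mult intro!: mult_mono)
  qed
  then show ?thesis using a h(1) by (intro integrable_const_bound) (auto simp: Linf_def)
qed

lemma weighted_bounded_convergence:
  fixes a :: "'a::euclidean_space \<Rightarrow> real"
  assumes \<Omega>: "open \<Omega>" "bounded \<Omega>" and a: "a \<in> Linf \<Omega>"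
    and h: "\<And>n. h n \<in> borel_measurable (lebesgue_on \<Omega>)" "\<And>n x. x \<in> \<Omega> \<Longrightarrow> \<bar>h n x\<bar> \<le> B"
    and k: "k \<in> borel_measurable (lebesgue_on \<Omega>)" "\<And>x. x \<in> \<Omega> \<Longrightarrow> (\<lambda>n. h n x) \<longlonglongrightarrow> k x"
  shows "(\<lambda>n. LINT x|lebesgue_on \<Omega>. a x * h n x) \<longlonglongrightarrow> (LINT x|lebesgue_on \<Omega>. a x * k x)"
proof -
  interpret finite_measure "lebesgue_on \<Omega>" by (rule finite_measure_bounded_open[OF \<Omega>])
  obtain A where A: "0 \<le> A" "AE x in lebesgue_on \<Omega>. norm (a x) \<le> A" using Linf_AE_bound[OF a] by blast
  have [measurable]: "a \<in> borel_measurable (lebesgue_on \<Omega>)" using a by (simp add: Linf_def)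
  note [measurable] = h(1) k(1)
  show ?thesis
  proof (rule integral_dominated_convergence[where w = "\<lambda>_. A * B"])
    show "AE x in lebesgue_on \<Omega>. norm (a x * h n x) \<le> A * B" for n
      using A(2) AE_space
    proof eventually_elim
      case (elim x)
      then show ?case using h(2)[of x n] A(1) by (auto simp: abs_mult intro!: mult_mono)
    qed
    show "AE x in lebesgue_on \<Omega>. (\<lambda>n. a x * h n x) \<longlonglongrightarrow> a x * k x"
      by (rule AE_I2) (auto intro!: tendsto_intros k(2))
  qed auto
qed

lemma Cbar_compose:
  assumes "continuous_on UNIV \<psi>" "u \<in> Cbar \<Omega>"
  shows "(\<lambda>x. \<psi> (u x)) \<in> Cbar \<Omega>"
  using assms continuous_on_compose2[of UNIV \<psi> "closure \<Omega>" u] by (simp add: Cbar_def)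

text \<open>The values of all but finitely many of the functions lie in one compact interval, on which
  \<open>\<psi>\<close> is bounded.\<close>

lemma weighted_integral_uniform_limit:
  fixes a :: "'a::euclidean_space \<Rightarrow> real"
  assumes \<Omega>: "open \<Omega>" "bounded \<Omega>" and a: "a \<in> Linf \<Omega>" and \<psi>: "continuous_on UNIV \<psi>"
    and v: "\<And>n. v n \<in> Cbar \<Omega>" and u: "u \<in> Cbar \<Omega>" and lim: "uniform_limit (closure \<Omega>) v u sequentially"
  shows "(\<lambda>n. LINT x|lebesgue_on \<Omega>. a x * \<psi> (v n x)) \<longlonglongrightarrow> (LINT x|lebesgue_on \<Omega>. a x * \<psi> (u x))"
proof -
  obtain B where B: "\<And>x. x \<in> closure \<Omega> \<Longrightarrow> \<bar>u x\<bar> \<le> B" using Cbar_measurable_bounded(2)[OF \<Omega> u] by blast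
  from uniform_limitD[OF lim zero_less_one]
  obtain N where N: "\<And>n x. n \<ge> N \<Longrightarrow> x \<in> closure \<Omega> \<Longrightarrow> dist (v n x) (u x) < 1"
    by (auto simp: eventually_sequentially)
  define R where "R = {- (B + 1)..B + 1}"
  have "bounded (\<psi> ` R)"
    unfolding R_def by (intro compact_imp_bounded compact_continuous_image continuous_on_subset[OF \<psi>]) auto
  then obtain D where D: "\<And>s. s \<in> R \<Longrightarrow> \<bar>\<psi> s\<bar> \<le> D"
    unfolding bounded_iff by auto
  \<comment> \<open>the first N functions need not obey the common bound, so they are skipped\<close>
  have "(\<lambda>n. LINT x|lebesgue_on \<Omega>. a x * \<psi> (v (n + N) x)) \<longlonglongrightarrow> (LINT x|lebesgue_on \<Omega>. a x * \<psi> (u x))"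
  proof (rule weighted_bounded_convergence[OF \<Omega> a])
    show "(\<lambda>x. \<psi> (v (n + N) x)) \<in> borel_measurable (lebesgue_on \<Omega>)" for n
      by (rule Cbar_measurable_bounded(1)[OF \<Omega> Cbar_compose[OF \<psi> v]])
    show "(\<lambda>x. \<psi> (u x)) \<in> borel_measurable (lebesgue_on \<Omega>)"
      by (rule Cbar_measurable_bounded(1)[OF \<Omega> Cbar_compose[OF \<psi> u]])
    fix x assume "x \<in> \<Omega>"
    then have x: "x \<in> closure \<Omega>" using closure_subset by blast
    show "\<bar>\<psi> (v (n + N) x)\<bar> \<le> D" for n
      using N[of "n + N", OF _ x] B[OF x] by (intro D) (auto simp: R_def dist_real_def abs_less_iff abs_le_iff)
    have "(\<lambda>n. v (n + N) x) \<longlonglongrightarrow> u x"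
      using tendsto_uniform_limitI[OF lim x] by (rule LIMSEQ_ignore_initial_segment)
    moreover have "isCont \<psi> (u x)" using \<psi> by (simp add: continuous_on_eq_continuous_at)
    ultimately show "(\<lambda>n. \<psi> (v (n + N) x)) \<longlonglongrightarrow> \<psi> (u x)" by (rule isCont_tendsto_compose[rotated])
  qed
  then show ?thesis by (rule LIMSEQ_offset)
qed

text \<open>Differentiation under the integral sign: on the compact interval that contains all the values,
  \<open>\<psi>\<close> is Lipschitz, which dominates the difference quotients.\<close>

lemma weighted_integral_first_variation:
  fixes a :: "'a::euclidean_space \<Rightarrow> real"
  assumes \<Omega>: "open \<Omega>" "bounded \<Omega>" and a: "a \<in> Linf \<Omega>"
    and \<psi>: "\<And>s. (\<psi> has_real_derivative \<psi>' s) (at s)" and \<psi>': "continuous_on UNIV \<psi>'"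
    and u: "u \<in> Cbar \<Omega>" and \<phi>: "continuous_on UNIV \<phi>"
    and t: "t \<longlonglongrightarrow> 0" "\<And>n. 0 < t n" "\<And>n. t n \<le> 1"
  shows "(\<lambda>n. ((LINT x|lebesgue_on \<Omega>. a x * \<psi> (u x + t n * \<phi> x)) - (LINT x|lebesgue_on \<Omega>. a x * \<psi> (u x))) / t n)
    \<longlonglongrightarrow> (LINT x|lebesgue_on \<Omega>. a x * (\<psi>' (u x) * \<phi> x))"
proof -
  have \<phi>C: "\<phi> \<in> Cbar \<Omega>" using \<phi> by (auto simp: Cbar_def intro: continuous_on_subset)
  have \<psi>c: "continuous_on UNIV \<psi>"
    using \<psi> by (intro continuous_at_imp_continuous_on) (auto intro: DERIV_isCont)
  obtain B where B: "\<And>x. x \<in> closure \<Omega> \<Longrightarrow> \<bar>u x\<bar> \<le> B" using Cbar_measurable_bounded(2)[OF \<Omega> u] by blast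
  obtain C where C: "\<And>x. x \<in> closure \<Omega> \<Longrightarrow> \<bar>\<phi> x\<bar> \<le> C" using Cbar_measurable_bounded(2)[OF \<Omega> \<phi>C] by blast
  define R where "R = {- (B + C)..B + C}"
  have "bounded (\<psi>' ` R)"
    unfolding R_def by (intro compact_imp_bounded compact_continuous_image continuous_on_subset[OF \<psi>']) auto
  then obtain D where D: "\<And>s. s \<in> R \<Longrightarrow> norm (\<psi>' s) \<le> D" unfolding bounded_iff by auto
  have lip: "\<bar>\<psi> y - \<psi> x\<bar> \<le> D * \<bar>y - x\<bar>" if "x \<in> R" "y \<in> R" for x y
    using field_differentiable_bound[of R \<psi> \<psi>' D x y] that D has_field_derivative_at_within[OF \<psi>]
    by (auto simp: R_def abs_minus_commute)
  have wC: "(\<lambda>x. u x + t n * \<phi> x) \<in> Cbar \<Omega>" for n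
    using u \<phi>C by (auto simp: Cbar_def intro!: continuous_intros)
  have bnd: "u x \<in> R" "u x + t n * \<phi> x \<in> R" if "x \<in> \<Omega>" for n x
  proof -
    have x: "x \<in> closure \<Omega>" using that closure_subset by blast
    have "\<bar>t n * \<phi> x\<bar> \<le> 1 * C"
      unfolding abs_mult using t(2,3)[of n] C[OF x] by (intro mult_mono) auto
    then show "u x \<in> R" "u x + t n * \<phi> x \<in> R"
      using B[OF x] C[OF x] by (auto simp: R_def abs_le_iff)
  qed
  have meas [measurable]: "(\<lambda>x. \<psi> (u x + t n * \<phi> x)) \<in> borel_measurable (lebesgue_on \<Omega>)"
    "(\<lambda>x. \<psi> (u x)) \<in> borel_measurable (lebesgue_on \<Omega>)"
    "(\<lambda>x. \<psi>' (u x)) \<in> borel_measurable (lebesgue_on \<Omega>)"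
    "\<phi> \<in> borel_measurable (lebesgue_on \<Omega>)" for n
    by (intro Cbar_measurable_bounded(1)[OF \<Omega>] Cbar_compose[OF \<psi>c] Cbar_compose[OF \<psi>'] wC u \<phi>C)+
  have "bounded (\<psi> ` R)"
    unfolding R_def by (intro compact_imp_bounded compact_continuous_image continuous_on_subset[OF \<psi>c]) auto
  then obtain E where E: "\<And>s. s \<in> R \<Longrightarrow> \<bar>\<psi> s\<bar> \<le> E" unfolding bounded_iff by auto
  have int: "integrable (lebesgue_on \<Omega>) (\<lambda>x. a x * \<psi> (u x + t n * \<phi> x))"
    "integrable (lebesgue_on \<Omega>) (\<lambda>x. a x * \<psi> (u x))" for n
    by (rule integrable_weighted[OF \<Omega> a meas(1) E[OF bnd(2)]] integrable_weighted[OF \<Omega> a meas(2) E[OF bnd(1)]];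
        assumption)+
  define Q where "Q n x = (\<psi> (u x + t n * \<phi> x) - \<psi> (u x)) / t n" for n x
  have "(\<lambda>n. LINT x|lebesgue_on \<Omega>. a x * Q n x) \<longlonglongrightarrow> (LINT x|lebesgue_on \<Omega>. a x * (\<psi>' (u x) * \<phi> x))"
  proof (rule weighted_bounded_convergence[OF \<Omega> a])
    show "Q n \<in> borel_measurable (lebesgue_on \<Omega>)" for n unfolding Q_def[abs_def] by measurable
    show "(\<lambda>x. \<psi>' (u x) * \<phi> x) \<in> borel_measurable (lebesgue_on \<Omega>)" by measurable
    fix x assume x: "x \<in> \<Omega>"
    have "0 \<le> D" using D[OF bnd(1)[OF x]] by (rule order_trans[OF norm_ge_zero])
    show "\<bar>Q n x\<bar> \<le> D * C" for n
    proof -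
      have "\<bar>\<psi> (u x + t n * \<phi> x) - \<psi> (u x)\<bar> \<le> D * \<bar>t n * \<phi> x\<bar>"
        using lip[OF bnd(1)[OF x] bnd(2)[OF x, of n]] by simp
      also have "\<dots> = t n * (D * \<bar>\<phi> x\<bar>)" using t(2)[of n] by (simp add: abs_mult)
      also have "\<dots> \<le> t n * (D * C)"
        using \<open>0 \<le> D\<close> t(2)[of n] C[OF subsetD[OF closure_subset x]]
        by (intro mult_left_mono) (auto simp: less_imp_le)
      finally show ?thesis using t(2)[of n] by (simp add: Q_def pos_divide_le_eq mult.commute)
    qed
    have "((\<lambda>s. u x + s * \<phi> x) has_real_derivative \<phi> x) (at 0)" by (auto intro!: derivative_eq_intros)
    moreover have "(\<psi> has_real_derivative \<psi>' (u x)) (at (u x + 0 * \<phi> x))" using \<psi> by simp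
    ultimately have "((\<lambda>s. \<psi> (u x + s * \<phi> x)) has_real_derivative \<psi>' (u x) * \<phi> x) (at 0)"
      by (rule DERIV_chain2[rotated])
    then have "((\<lambda>s. (\<psi> (u x + s * \<phi> x) - \<psi> (u x)) / s) \<longlongrightarrow> \<psi>' (u x) * \<phi> x) (at 0)"
      by (simp add: DERIV_def)
    moreover have "filterlim t (at 0) sequentially"
    proof -
      have "t n \<noteq> 0" for n using t(2)[of n] by simp
      then show ?thesis using t(1) by (simp add: filterlim_at)
    qed
    ultimately show "(\<lambda>n. Q n x) \<longlonglongrightarrow> \<psi>' (u x) * \<phi> x"
      unfolding Q_def by (rule filterlim_compose)
  qed
  moreover have "(LINT x|lebesgue_on \<Omega>. a x * Q n x) =
      ((LINT x|lebesgue_on \<Omega>. a x * \<psi> (u x + t n * \<phi> x)) - (LINT x|lebesgue_on \<Omega>. a x * \<psi> (u x))) / t n" for n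
  proof -
    have "(LINT x|lebesgue_on \<Omega>. a x * Q n x) =
        (LINT x|lebesgue_on \<Omega>. (a x * \<psi> (u x + t n * \<phi> x) - a x * \<psi> (u x)) / t n)"
      by (simp add: Q_def right_diff_distrib)
    also have "\<dots> = ((LINT x|lebesgue_on \<Omega>. a x * \<psi> (u x + t n * \<phi> x)) - (LINT x|lebesgue_on \<Omega>. a x * \<psi> (u x))) / t n"
      using int by simp
    finally show ?thesis .
  qed
  ultimately show ?thesis by simp
qed

lemma has_real_derivative_abs_powr:
  fixes p :: real
  assumes "p > 1"
  shows "((\<lambda>s. \<bar>s\<bar> powr p) has_real_derivative p * (\<bar>s\<bar> powr (p - 2) * s)) (at s)"
proof (cases s "0::real" rule: linorder_cases)
  case greater
  have "((\<lambda>s. s powr p) has_real_derivative p * s powr (p - 1)) (at s)"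
    using greater by (rule has_real_derivative_powr)
  moreover have "s powr (p - 1) = \<bar>s\<bar> powr (p - 2) * s"
    using greater powr_add[of s "p - 2" 1] by simp
  ultimately have "((\<lambda>s. s powr p) has_real_derivative p * (\<bar>s\<bar> powr (p - 2) * s)) (at s)" by simp
  then show ?thesis
    by (rule has_field_derivative_transform_within_open[of _ _ _ "{0<..}"]) (use greater in auto)
next
  case less
  have "((\<lambda>s. (- s) powr p) has_real_derivative p * (- s) powr (p - 1) * (- 1)) (at s)"
    using less by (auto intro!: derivative_eq_intros)
  moreover have "p * (- s) powr (p - 1) * (- 1) = p * (\<bar>s\<bar> powr (p - 2) * s)"
    using less powr_add[of "- s" "p - 2" 1] by simp
  ultimately have "((\<lambda>s. (- s) powr p) has_real_derivative p * (\<bar>s\<bar> powr (p - 2) * s)) (at s)" by simp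
  then show ?thesis
    by (rule has_field_derivative_transform_within_open[of _ _ _ "{..<0}"]) (use less in auto)
next
  case equal
  have "((\<lambda>h. \<bar>h\<bar> powr p / h) \<longlongrightarrow> 0) (at (0::real))"
  proof (rule Lim_null_comparison)
    show "\<forall>\<^sub>F h in at (0::real). norm (\<bar>h\<bar> powr p / h) \<le> \<bar>h\<bar> powr (p - 1)"
      unfolding eventually_at_filter
      by (rule always_eventually) (auto simp: abs_divide powr_diff)
    have "((\<lambda>h::real. \<bar>h\<bar> powr (p - 1)) \<longlongrightarrow> \<bar>0\<bar> powr (p - 1)) (at 0)"
      using assms by (intro tendsto_powr' tendsto_intros) auto
    then show "((\<lambda>h::real. \<bar>h\<bar> powr (p - 1)) \<longlongrightarrow> 0) (at 0)" by simp
  qed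
  then show ?thesis using equal assms by (simp add: DERIV_def)
qed

lemma continuous_on_signed_powr:
  fixes p :: real
  assumes "p > 2"
  shows "continuous_on UNIV (\<lambda>s::real. \<bar>s\<bar> powr (p - 2) * s)"
  using assms by (intro continuous_intros continuous_on_powr') auto

lemma continuous_on_abs_powr:
  fixes p :: real
  assumes "p > 0"
  shows "continuous_on UNIV (\<lambda>s::real. \<bar>s\<bar> powr p)"
  using assms by (intro continuous_intros continuous_on_powr') auto

section \<open>Minimizers, their limits, and maximality\<close>

lemma Psi_fun_bounds:
  assumes \<Omega>: "open \<Omega>" "bounded \<Omega>" and u: "u \<in> K_set \<Omega>"
  obtains P where "Psi_fun \<Omega> u = ereal P" "0 \<le> P" "P \<le> measure lebesgue \<Omega>"
proof -
  interpret finite_measure "lebesgue_on \<Omega>" by (rule finite_measure_bounded_open[OF \<Omega>])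
  define P where "P = (LINT x|lebesgue_on \<Omega>. 1 - sqrt (1 - (norm (wgrad \<Omega> u x))\<^sup>2))"
  have le: "Linf_norm \<Omega> (wgrad \<Omega> u) \<le> 1" using u by (simp add: K_set_def)
  have ae: "AE x in lebesgue_on \<Omega>. 0 \<le> 1 - sqrt (1 - (norm (wgrad \<Omega> u x))\<^sup>2) \<and>
      1 - sqrt (1 - (norm (wgrad \<Omega> u x))\<^sup>2) \<le> 1"
    using AE_norm_le_Linf_norm[where S = \<Omega> and f = "wgrad \<Omega> u"]
  proof eventually_elim
    case (elim x)
    then have "ereal (norm (wgrad \<Omega> u x)) \<le> 1" using le by (rule order_trans)
    then have "(norm (wgrad \<Omega> u x))\<^sup>2 \<le> 1" by (simp add: power_le_one)
    then show ?case by simp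
  qed
  have "0 \<le> P" unfolding P_def by (rule integral_nonneg_AE) (use ae in eventually_elim, simp)
  moreover have "P \<le> (LINT x|lebesgue_on \<Omega>. 1)"
    unfolding P_def by (rule integral_mono_AE') (use ae in \<open>simp, eventually_elim, simp, simp\<close>)
  moreover have "(LINT x|lebesgue_on \<Omega>. 1) = measure lebesgue \<Omega>"
    using \<Omega>(1) by (simp add: measure_restrict_space)
  ultimately show thesis using that[of P] u by (simp add: Psi_fun_def P_def)
qed

text \<open>The gradient part of the energy lies between 0 and the volume of the domain, so a minimizer can
  miss the supremum of \<open>J\<close> on the constraint set only by an amount of order \<open>1 / lam\<close>.\<close>

lemma J_fun_le_of_minimizer:
  assumes \<Omega>: "open \<Omega>" "bounded \<Omega>" and p: "p > 0" and lam: "lam > 0"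
    and u: "u \<in> K_set \<Omega>" and v: "v \<in> K_set \<Omega>"
    and mini: "I_fun \<Omega> a p lam u = (INF w\<in>Cbar \<Omega>. I_fun \<Omega> a p lam w)"
  shows "J_fun \<Omega> a p v \<le> J_fun \<Omega> a p u + p * measure lebesgue \<Omega> / lam"
proof -
  obtain P where P: "Psi_fun \<Omega> u = ereal P" "0 \<le> P" using Psi_fun_bounds[OF \<Omega> u] by metis
  obtain Q where Q: "Psi_fun \<Omega> v = ereal Q" "Q \<le> measure lebesgue \<Omega>" using Psi_fun_bounds[OF \<Omega> v] by metis
  have "v \<in> Cbar \<Omega>" using v by (simp add: K_set_def W1inf_def)
  then have "I_fun \<Omega> a p lam u \<le> I_fun \<Omega> a p lam v" unfolding mini by (rule INF_lower)
  then have "P - lam / p * J_fun \<Omega> a p u \<le> Q - lam / p * J_fun \<Omega> a p v"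
    by (simp add: I_fun_def P(1) Q(1) Phi_fun_def J_fun_def)
  then have "lam / p * J_fun \<Omega> a p v \<le> lam / p * J_fun \<Omega> a p u + measure lebesgue \<Omega>"
    using P(2) Q(2) by linarith
  from mult_left_mono[OF this, of "p / lam"]
  show ?thesis using p lam by (simp add: distrib_left)
qed

text \<open>Where the gradient stays away from 1 there is room for a small multiple of any test
  function; outside the support of the test function nothing changes.\<close>

lemma K_set_perturb:
  assumes \<Omega>: "open \<Omega>" "bounded \<Omega>" and u: "u \<in> K_set \<Omega>"
    and U: "open U" "U \<subseteq> \<Omega>" "Linf_norm U (wgrad \<Omega> u) < 1" and t: "C1c_test U \<phi> g"
  obtains \<tau> where "0 < \<tau>" "\<tau> \<le> 1" "\<And>s. 0 \<le> s \<Longrightarrow> s \<le> \<tau> \<Longrightarrow> (\<lambda>x. u x + s * \<phi> x) \<in> K_set \<Omega>"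
proof -
  obtain G where uC: "u \<in> Cbar \<Omega>" and G: "unit_gradient \<Omega> u G" and ae: "AE x in lebesgue_on \<Omega>. wgrad \<Omega> u x = G x"
    using in_K_setE[OF \<Omega>(1) u] by metis
  obtain \<theta> where \<theta>: "Linf_norm U (wgrad \<Omega> u) \<le> ereal \<theta>" "\<theta> < 1"
  proof (cases "Linf_norm U (wgrad \<Omega> u)")
    case (real r)
    then show thesis using that[of r] U(3) by simp
  next
    case PInf
    then show thesis using U(3) by simp
  next
    case MInf
    then show thesis using that[of 0] by simp
  qed
  obtain C B where C: "C \<subseteq> U" "\<And>x. x \<notin> C \<Longrightarrow> g x = 0" and B: "0 \<le> B" "\<And>x. norm (g x) \<le> B"
    using C1c_test_E[OF t] by metis
  \<comment> \<open>chosen so that theta + tau * B is at most 1; adding 1 to B avoids division by zero\<close>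
  define \<tau> where "\<tau> = min 1 ((1 - \<theta>) / (B + 1))"
  have \<tau>: "0 < \<tau>" "\<tau> \<le> 1" using \<theta>(2) B(1) by (auto simp: \<tau>_def)
  have "\<tau> * B \<le> (1 - \<theta>) / (B + 1) * B" using B(1) by (intro mult_right_mono) (auto simp: \<tau>_def)
  also have "\<dots> \<le> 1 - \<theta>" using B(1) \<theta>(2) by (simp add: field_simps)
  finally have \<tau>B: "\<tau> * B \<le> 1 - \<theta>" .
  have sm: "\<Omega> \<in> sets lebesgue" "U \<in> sets lebesgue" using \<Omega>(1) U(1) by auto
  have "AE x in lebesgue. x \<in> U \<longrightarrow> norm (wgrad \<Omega> u x) \<le> \<theta>"
  proof -
    have "AE x in lebesgue_on U. norm (wgrad \<Omega> u x) \<le> \<theta>"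
      using AE_norm_le_Linf_norm[where S = U and f = "wgrad \<Omega> u"]
    proof eventually_elim
      case (elim x)
      then have "ereal (norm (wgrad \<Omega> u x)) \<le> ereal \<theta>" using \<theta>(1) by (rule order_trans)
      then show ?case by simp
    qed
    then show ?thesis using sm(2) by (simp add: AE_restrict_space_iff)
  qed
  moreover have "AE x in lebesgue. x \<in> \<Omega> \<longrightarrow> wgrad \<Omega> u x = G x"
    using ae sm(1) by (simp add: AE_restrict_space_iff)
  ultimately have "AE x in lebesgue. x \<in> \<Omega> \<longrightarrow> (x \<in> U \<longrightarrow> norm (G x) \<le> \<theta>)"
    by eventually_elim auto
  then have small: "AE x in lebesgue_on \<Omega>. x \<in> U \<longrightarrow> norm (G x) \<le> \<theta>"
    using sm(1) by (simp add: AE_restrict_space_iff)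
  have D: "\<And>x. GDERIV \<phi> x :> g x" using t by (simp add: C1c_test_def)
  note cont = C1c_test_continuous[OF t]
  have gm: "g \<in> borel_measurable (lebesgue_on \<Omega>)"
    using cont(2) by (simp add: borel_measurable_continuous_onI measurable_restrict_space1 measurable_completion)
  have "(\<lambda>x. u x + s * \<phi> x) \<in> K_set \<Omega>" if s: "0 \<le> s" "s \<le> \<tau>" for s
  proof -
    define w where "w x = 1 * u x + s * \<phi> x" for x
    define H where "H x = 1 *\<^sub>R G x + s *\<^sub>R g x" for x
    have "has_weak_gradient \<Omega> w H"
      unfolding w_def[abs_def] H_def[abs_def]
      using G by (intro has_weak_gradient_lincomb[OF \<Omega>(1)] has_weak_gradient_C1[OF \<Omega>(1) D cont(2)])
        (simp add: unit_gradient_def)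
    moreover have "H \<in> borel_measurable (lebesgue_on \<Omega>)"
      using G gm unfolding H_def[abs_def] unit_gradient_def by auto
    moreover have "AE x in lebesgue_on \<Omega>. norm (H x) \<le> 1"
      using small AE_space
    proof eventually_elim
      case (elim x)
      show ?case
      proof (cases "x \<in> U")
        case True
        have "norm (H x) \<le> norm (G x) + s * norm (g x)"
          using norm_triangle_ineq[of "G x" "s *\<^sub>R g x"] s(1) by (simp add: H_def)
        also have "\<dots> \<le> \<theta> + \<tau> * B"
          using elim(1) True s B \<tau> by (intro add_mono mult_mono) auto
        finally show ?thesis using \<tau>B by simp
      next
        case False
        then have "g x = 0" using C by auto
        then show ?thesis using G elim(2) by (simp add: H_def unit_gradient_def)
      qed
    qed
    ultimately obtain H' where "unit_gradient \<Omega> w H'"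
      using unit_gradient_if_AE_norm_le_1[OF \<Omega>(1)] by blast
    moreover have "w \<in> Cbar \<Omega>"
      using uC cont(1) unfolding Cbar_def w_def[abs_def]
      by (auto intro!: continuous_intros intro: continuous_on_subset)
    ultimately have "w \<in> K_set \<Omega>" by (intro in_K_setI[OF \<Omega>])
    then show ?thesis by (simp add: w_def[abs_def])
  qed
  with \<tau> show thesis by (rule that)
qed

text \<open>A bump supported in a box on which the weight is positive, scaled down until its gradient is at
  most 1.\<close>

lemma exists_K_set_J_fun_pos:
  fixes \<Omega> :: "'a::euclidean_space set"
  assumes \<Omega>: "open \<Omega>" "bounded \<Omega>" and a: "a \<in> Linf \<Omega>" and p: "p > 0"
    and plus: "interior {x \<in> \<Omega>. a x > 0} \<noteq> {}"
  obtains v where "v \<in> K_set \<Omega>" "J_fun \<Omega> a p v > 0"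
proof -
  obtain z where z: "z \<in> interior {x \<in> \<Omega>. a x > 0}" using plus by blast
  obtain c d where cd: "z \<in> box c d" "cbox c d \<subseteq> interior {x \<in> \<Omega>. a x > 0}"
    by (rule open_contains_cbox[OF open_interior z]) (rule that)
  have sub: "cbox c d \<subseteq> {x \<in> \<Omega>. a x > 0}" using cd(2) interior_subset by (rule order_trans)
  have ne: "box c d \<noteq> {}" using cd(1) by blast
  obtain q g where q: "\<And>x. GDERIV q x :> g x" "continuous_on UNIV g" "\<And>x. 0 \<le> q x"
    "\<And>x. 0 < q x \<longleftrightarrow> x \<in> box c d"
    using box_bump[OF ne] by metis
  have q0: "q x = 0" if "x \<notin> box c d" for x using q(3,4)[of x] that by simp
  have test: "C1c_test \<Omega> q g"
    unfolding C1c_test_def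
  proof (intro conjI)
    show "\<exists>C. compact C \<and> C \<subseteq> \<Omega> \<and> (\<forall>x. x \<notin> C \<longrightarrow> q x = 0)"
      using sub q0 box_subset_cbox[of c d] by (intro exI[of _ "cbox c d"]) auto
  qed (use q in auto)
  obtain B where B: "0 \<le> B" "\<And>x. \<bar>q x\<bar> \<le> B" "\<And>x. norm (g x) \<le> B" using C1c_test_E[OF test] by metis
  define k where "k = 1 / (B + 1)"
  have k: "0 < k" "k * B \<le> 1" using B(1) by (auto simp: k_def)
  define v where "v x = 0 * q x + k * q x" for x
  define H where "H x = 0 *\<^sub>R g x + k *\<^sub>R g x" for x
  note cont = C1c_test_continuous[OF test]
  have "g \<in> borel_measurable (lebesgue_on \<Omega>)"
    using cont(2) by (simp add: borel_measurable_continuous_onI measurable_restrict_space1 measurable_completion)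
  moreover have "norm (H x) \<le> 1" for x
  proof -
    have "k * norm (g x) \<le> k * B" using k(1) B(3) by (intro mult_left_mono) auto
    then have "k * norm (g x) \<le> 1" using k(2) by (rule order_trans)
    then show ?thesis using k(1) by (simp add: H_def)
  qed
  moreover have "has_weak_gradient \<Omega> v H"
    unfolding v_def[abs_def] H_def[abs_def]
    by (intro has_weak_gradient_lincomb[OF \<Omega>(1)] has_weak_gradient_C1[OF \<Omega>(1) q(1,2)])
  ultimately have "unit_gradient \<Omega> v H"
    unfolding unit_gradient_def by (auto simp: H_def[abs_def])
  moreover have vc: "continuous_on UNIV v" unfolding v_def[abs_def] by (intro continuous_intros cont)
  then have vC: "v \<in> Cbar \<Omega>" by (auto simp: Cbar_def intro: continuous_on_subset)
  ultimately have vK: "v \<in> K_set \<Omega>" by (intro in_K_setI[OF \<Omega>])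
  have int: "integrable (lebesgue_on \<Omega>) (\<lambda>x. a x * \<bar>v x\<bar> powr p)"
  proof (rule integrable_weighted[OF \<Omega> a])
    show "(\<lambda>x. \<bar>v x\<bar> powr p) \<in> borel_measurable (lebesgue_on \<Omega>)"
      by (rule Cbar_measurable_bounded(1)[OF \<Omega> Cbar_compose[OF continuous_on_abs_powr[OF p] vC]])
    show "\<bar>\<bar>v x\<bar> powr p\<bar> \<le> (k * B) powr p" for x
      using k(1) B(2)[of x] p by (auto simp: v_def abs_mult intro!: powr_mono2 mult_left_mono)
  qed
  have nn: "0 \<le> a x * \<bar>v x\<bar> powr p" if "x \<in> \<Omega>" for x
  proof (cases "x \<in> cbox c d")
    case True
    then have "0 < a x" using sub by blast
    then show ?thesis by simp
  next
    case False
    then have "q x = 0" using q0 box_subset_cbox[of c d] by blast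
    then show ?thesis using p by (simp add: v_def)
  qed
  then have "0 \<le> J_fun \<Omega> a p v"
    unfolding J_fun_def by (intro Bochner_Integration.integral_nonneg) auto
  moreover have "J_fun \<Omega> a p v \<noteq> 0"
  proof
    assume "J_fun \<Omega> a p v = 0"
    moreover have "AE x in lebesgue_on \<Omega>. 0 \<le> a x * \<bar>v x\<bar> powr p"
      by (rule AE_I2) (use nn in simp)
    ultimately have "AE x in lebesgue_on \<Omega>. a x * \<bar>v x\<bar> powr p = 0"
      using integral_nonneg_eq_0_iff_AE[OF int] unfolding J_fun_def by simp
    then have "negligible {x \<in> \<Omega>. a x * \<bar>v x\<bar> powr p \<noteq> 0}"
      using \<Omega>(1) by (simp add: AE_lebesgue_on_iff_negligible)
    moreover have "box c d \<subseteq> {x \<in> \<Omega>. a x * \<bar>v x\<bar> powr p \<noteq> 0}"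
    proof
      fix x assume x: "x \<in> box c d"
      then have "x \<in> \<Omega>" "0 < a x" using sub box_subset_cbox[of c d] by auto
      moreover have "0 < v x" using x q(4) k(1) by (simp add: v_def)
      ultimately show "x \<in> {x \<in> \<Omega>. a x * \<bar>v x\<bar> powr p \<noteq> 0}" by simp
    qed
    ultimately have "negligible (box c d)" by (rule negligible_subset)
    then show False using ne by (simp add: negligible_interval)
  qed
  ultimately show thesis using vK by (intro that) auto
qed

lemma integral_lebesgue_on_support:
  fixes f :: "'a::euclidean_space \<Rightarrow> 'b::euclidean_space"
  assumes "open \<Omega>" "open U" "U \<subseteq> \<Omega>" "\<And>x. x \<notin> U \<Longrightarrow> f x = 0"
  shows "(LINT x|lebesgue_on U. f x) = (LINT x|lebesgue_on \<Omega>. f x)"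
proof -
  have "U \<in> sets lebesgue" "\<Omega> \<in> sets lebesgue" using assms(1,2) by auto
  moreover have "f x = 0" if "x \<notin> \<Omega>" for x using assms(3,4) that by blast
  ultimately show ?thesis using assms(4) by (simp add: integral_lebesgue_on_eq)
qed

text \<open>Variations in \<open>U\<close> are admissible in both directions (replace a test function by its negative), so
  the first variation of \<open>J\<close> vanishes there:
  \<open>a * \<bar>u\<bar> powr (p - 2) * u = 0\<close> almost everywhere in \<open>U\<close>. As \<open>a \<noteq> 0\<close>, this gives \<open>u = 0\<close>
  almost everywhere, hence everywhere by continuity.\<close>

theorem maximizer_vanishes_where_unconstrained:
  fixes \<Omega> :: "'a::euclidean_space set"
  assumes \<Omega>: "open \<Omega>" "bounded \<Omega>" and a: "a \<in> Linf \<Omega>" and p: "p > 2"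
    and u: "u \<in> K_set \<Omega>" and max: "\<And>v. v \<in> K_set \<Omega> \<Longrightarrow> J_fun \<Omega> a p v \<le> J_fun \<Omega> a p u"
    and U: "open U" "U \<subseteq> \<Omega>" "Linf_norm U (wgrad \<Omega> u) < 1" "AE x in lebesgue_on U. a x \<noteq> 0"
    and x: "x \<in> U"
  shows "u x = 0"
proof -
  have uC: "u \<in> Cbar \<Omega>" using u by (simp add: K_set_def W1inf_def)
  define f where "f x = a x * (\<bar>u x\<bar> powr (p - 2) * u x)" for x
  have le: "(LINT x|lebesgue_on \<Omega>. \<phi> x *\<^sub>R f x) \<le> 0" if t: "C1c_test U \<phi> g" for \<phi> g
  proof -
    obtain \<tau> where \<tau>: "0 < \<tau>" "\<tau> \<le> 1" "\<And>s. 0 \<le> s \<Longrightarrow> s \<le> \<tau> \<Longrightarrow> (\<lambda>x. u x + s * \<phi> x) \<in> K_set \<Omega>"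
      using K_set_perturb[OF \<Omega> u U(1-3) t] by metis
    define s where "s n = \<tau> / real (Suc n)" for n
    have s0: "0 < s n" "s n \<le> \<tau>" for n using \<tau>(1) by (auto simp: s_def field_simps)
    have "s \<longlonglongrightarrow> 0" unfolding s_def[abs_def] by real_asymp
    have "(\<lambda>n. ((LINT x|lebesgue_on \<Omega>. a x * \<bar>u x + s n * \<phi> x\<bar> powr p)
        - (LINT x|lebesgue_on \<Omega>. a x * \<bar>u x\<bar> powr p)) / s n)
      \<longlonglongrightarrow> (LINT x|lebesgue_on \<Omega>. a x * (p * (\<bar>u x\<bar> powr (p - 2) * u x) * \<phi> x))"
    proof (rule weighted_integral_first_variation[OF \<Omega> a _ _ uC C1c_test_continuous(1)[OF t] \<open>s \<longlonglongrightarrow> 0\<close> s0(1)])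
      show "((\<lambda>s. \<bar>s\<bar> powr p) has_real_derivative p * (\<bar>s\<bar> powr (p - 2) * s)) (at s)" for s
        using p by (intro has_real_derivative_abs_powr) simp
      show "continuous_on UNIV (\<lambda>s. p * (\<bar>s\<bar> powr (p - 2) * s))"
        by (intro continuous_on_mult_left continuous_on_signed_powr p)
      show "s n \<le> 1" for n using s0(2)[of n] \<tau>(2) by simp
    qed
    moreover have "((LINT x|lebesgue_on \<Omega>. a x * \<bar>u x + s n * \<phi> x\<bar> powr p)
        - (LINT x|lebesgue_on \<Omega>. a x * \<bar>u x\<bar> powr p)) / s n \<le> 0" for n
    proof -
      have "(\<lambda>x. u x + s n * \<phi> x) \<in> K_set \<Omega>" using \<tau>(3) s0[of n] by simp
      from max[OF this] show ?thesis using s0(1)[of n] by (simp add: J_fun_def divide_nonpos_pos)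
    qed
    ultimately have "(LINT x|lebesgue_on \<Omega>. a x * (p * (\<bar>u x\<bar> powr (p - 2) * u x) * \<phi> x)) \<le> 0"
      by (intro LIMSEQ_le_const2) auto
    moreover have "a x * (p * (\<bar>u x\<bar> powr (p - 2) * u x) * \<phi> x) = p * (\<phi> x *\<^sub>R f x)" for x
      by (simp add: f_def)
    ultimately show ?thesis using p by (simp add: mult_le_0_iff)
  qed
  have "AE x in lebesgue_on U. f x = 0"
  proof (rule fundamental_lemma_of_calculus_of_variations[OF U(1)])
    fix C assume C: "compact C" "C \<subseteq> U"
    obtain B where B: "\<And>x. x \<in> closure \<Omega> \<Longrightarrow> \<bar>\<bar>u x\<bar> powr (p - 2) * u x\<bar> \<le> B"
      using Cbar_measurable_bounded(2)[OF \<Omega> Cbar_compose[OF continuous_on_signed_powr[OF p] uC]] by blast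
    have "integrable (lebesgue_on \<Omega>) f"
      unfolding f_def[abs_def]
    proof (rule integrable_weighted[OF \<Omega> a])
      show "(\<lambda>x. \<bar>u x\<bar> powr (p - 2) * u x) \<in> borel_measurable (lebesgue_on \<Omega>)"
        by (rule Cbar_measurable_bounded(1)[OF \<Omega> Cbar_compose[OF continuous_on_signed_powr[OF p] uC]])
      show "\<bar>\<bar>u x\<bar> powr (p - 2) * u x\<bar> \<le> B" if "x \<in> \<Omega>" for x
        by (rule B[OF subsetD[OF closure_subset that]])
    qed
    then have "f absolutely_integrable_on \<Omega>"
      using \<Omega>(1) by (simp add: set_integrable_def integrable_restrict_space)
    then show "f absolutely_integrable_on C"
      by (rule set_integrable_subset) (use C U(2) in \<open>auto simp: compact_imp_closed\<close>)
  next
    fix \<phi> g assume t: "C1c_test U \<phi> g"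
    have "C1c_test U (\<lambda>x. - \<phi> x) (\<lambda>x. - g x)"
      using t unfolding C1c_test_def by (auto intro: GDERIV_minus continuous_on_minus)
    from le[OF this] have "0 \<le> (LINT x|lebesgue_on \<Omega>. \<phi> x *\<^sub>R f x)" by simp
    with le[OF t] have "(LINT x|lebesgue_on \<Omega>. \<phi> x *\<^sub>R f x) = 0" by simp
    moreover have "\<phi> x = 0" if "x \<notin> U" for x
      using t that unfolding C1c_test_def by blast
    ultimately show "(LINT x|lebesgue_on U. \<phi> x *\<^sub>R f x) = 0"
      using integral_lebesgue_on_support[OF \<Omega>(1) U(1,2), of "\<lambda>x. \<phi> x *\<^sub>R f x"] by simp
  qed
  with U(4) have "AE x in lebesgue_on U. u x = 0"
    by eventually_elim (auto simp: f_def)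
  then have "negligible {x \<in> U. u x \<noteq> 0}"
    using U(1) by (simp add: AE_lebesgue_on_iff_negligible)
  moreover have "open {x \<in> U. u x \<noteq> 0}"
  proof -
    have "U \<subseteq> closure \<Omega>" using U(2) closure_subset by (rule order_trans)
    then have "continuous_on U u" using uC by (auto simp: Cbar_def intro: continuous_on_subset)
    then have "open (U \<inter> u -` (- {0}))" using U(1) by (intro continuous_open_preimage) auto
    moreover have "U \<inter> u -` (- {0}) = {x \<in> U. u x \<noteq> 0}" by auto
    ultimately show ?thesis by simp
  qed
  ultimately have "{x \<in> U. u x \<noteq> 0} = {}" using open_not_negligible by blast
  then show ?thesis using x by blast
qed

text \<open>The Neumann problem admits the constant 1 as a test function.\<close>

lemma is_solution_in_Ka_set:
  assumes sol: "is_solution \<Omega> a p lam u" and lam: "lam > 0"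
  shows "u \<in> Ka_set \<Omega> a p"
proof -
  have W: "u \<in> W1inf \<Omega>" "Linf_norm \<Omega> (wgrad \<Omega> u) < 1"
    and eq: "\<And>\<phi> g. C1bar_test \<Omega> \<phi> g \<Longrightarrow>
      (LINT x|lebesgue_on \<Omega>. (wgrad \<Omega> u x \<bullet> g x) / sqrt (1 - (norm (wgrad \<Omega> u x))\<^sup>2)) =
      lam * (LINT x|lebesgue_on \<Omega>. a x * (\<bar>u x\<bar> powr (p - 2) * u x) * \<phi> x)"
    using sol unfolding is_solution_def by auto
  have "C1bar_test \<Omega> (\<lambda>_. 1) (\<lambda>_. 0)"
    by (auto simp: C1bar_test_def GDERIV_const)
  from eq[OF this] have "(LINT x|lebesgue_on \<Omega>. a x * (\<bar>u x\<bar> powr (p - 2) * u x)) = 0"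
    using lam by simp
  then show ?thesis using W by (simp add: Ka_set_def K_set_def less_imp_le)
qed

text \<open>The minimizers compete with every function of the constraint set, not only with those
  satisfying the integral condition; this is why the maximality holds over the larger set.\<close>

theorem limit_of_minimizers_maximizes_J_fun:
  fixes \<Omega> :: "'a::euclidean_space set"
  assumes \<Omega>: "open \<Omega>" "bounded \<Omega>" and a: "a \<in> Linf \<Omega>" and p: "p > 2"
    and l: "\<And>n. lams n > 0" "filterlim lams at_top sequentially"
    and w: "\<And>n. w n \<in> Ka_set \<Omega> a p"
    and mini: "\<And>n. I_fun \<Omega> a p (lams n) (w n) = (INF v\<in>Cbar \<Omega>. I_fun \<Omega> a p (lams n) v)"
    and lim: "uniform_limit (closure \<Omega>) w u sequentially"
  shows "u \<in> Ka_set \<Omega> a p" "v \<in> K_set \<Omega> \<Longrightarrow> J_fun \<Omega> a p v \<le> J_fun \<Omega> a p u"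
proof -
  have wK: "w n \<in> K_set \<Omega>" for n using w by (simp add: Ka_set_def)
  then have wC: "w n \<in> Cbar \<Omega>" for n by (simp add: K_set_def W1inf_def)
  have uK: "u \<in> K_set \<Omega>" by (rule K_set_uniform_limit[OF \<Omega> wK lim])
  then have uC: "u \<in> Cbar \<Omega>" by (simp add: K_set_def W1inf_def)
  have "(\<lambda>n. LINT x|lebesgue_on \<Omega>. a x * (\<bar>w n x\<bar> powr (p - 2) * w n x))
      \<longlonglongrightarrow> (LINT x|lebesgue_on \<Omega>. a x * (\<bar>u x\<bar> powr (p - 2) * u x))"
    by (rule weighted_integral_uniform_limit[OF \<Omega> a continuous_on_signed_powr[OF p] wC uC lim])
  moreover have "(LINT x|lebesgue_on \<Omega>. a x * (\<bar>w n x\<bar> powr (p - 2) * w n x)) = 0" for n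
    using w by (simp add: Ka_set_def)
  ultimately show "u \<in> Ka_set \<Omega> a p" using uK by (simp add: Ka_set_def LIMSEQ_const_iff)
  assume v: "v \<in> K_set \<Omega>"
  have "(\<lambda>n. J_fun \<Omega> a p (w n)) \<longlonglongrightarrow> J_fun \<Omega> a p u"
    unfolding J_fun_def
    by (rule weighted_integral_uniform_limit[OF \<Omega> a continuous_on_abs_powr wC uC lim]) (use p in simp)
  moreover have "(\<lambda>n. p * measure lebesgue \<Omega> / lams n) \<longlonglongrightarrow> 0"
    by (rule tendsto_divide_0[OF tendsto_const filterlim_at_top_imp_at_infinity[OF l(2)]])
  ultimately have "(\<lambda>n. J_fun \<Omega> a p (w n) + p * measure lebesgue \<Omega> / lams n) \<longlonglongrightarrow> J_fun \<Omega> a p u + 0"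
    by (rule tendsto_add)
  moreover have "J_fun \<Omega> a p v \<le> J_fun \<Omega> a p (w n) + p * measure lebesgue \<Omega> / lams n" for n
    by (rule J_fun_le_of_minimizer[OF \<Omega> _ l(1) wK v mini]) (use p in simp)
  ultimately show "J_fun \<Omega> a p v \<le> J_fun \<Omega> a p u"
    by (intro LIMSEQ_le_const) auto
qed

theorem corollary4p8:
  fixes \<Omega> :: "(real ^ 'n) set"
    and a :: "real ^ 'n \<Rightarrow> real"
    and p lam0 :: real
    and u :: "real \<Rightarrow> real ^ 'n \<Rightarrow> real"
    and lams :: "nat \<Rightarrow> real"
    and u_inf :: "real ^ 'n \<Rightarrow> real"
  assumes dim: "CARD('n) \<ge> 2"
    and dom: "open \<Omega>" "connected \<Omega>" "\<Omega> \<noteq> {}" "bounded \<Omega>" "convex \<Omega>" "C2_boundary \<Omega>"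
    and p_gt: "p > 2"
    and a_star: "a \<in> Linf \<Omega>" "(LINT x|lebesgue_on \<Omega>. a x) < 0"
    and a_plus: "interior {x \<in> \<Omega>. a x > 0} \<noteq> {}"
    and lam0_pos: "lam0 > 0"
    and sol: "\<And>lam. lam \<ge> lam0 \<Longrightarrow> is_solution \<Omega> a p lam (u lam)"
    and mini: "\<And>lam. lam \<ge> lam0 \<Longrightarrow> I_fun \<Omega> a p lam (u lam) = (INF v\<in>Cbar \<Omega>. I_fun \<Omega> a p lam v)"
    and lams_seq: "\<And>n. lams n \<ge> lam0" "filterlim lams at_top sequentially"
    and lim: "uniform_limit (closure \<Omega>) (\<lambda>n. u (lams n)) u_inf sequentially"
    and nonneg: "\<And>x. x \<in> closure \<Omega> \<Longrightarrow> u_inf x \<ge> 0"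
  shows "u_inf \<in> Ka_set \<Omega> a p \<and>
    (\<exists>M. M \<in> J_fun \<Omega> a p ` Ka_set \<Omega> a p \<and> (\<forall>v\<in>Ka_set \<Omega> a p. J_fun \<Omega> a p v \<le> M) \<and>
         J_fun \<Omega> a p u_inf = M \<and> M > 0) \<and>
    (\<exists>\<mu>\<ge>0.
       (\<forall>U. admissible_set \<Omega> a u_inf U \<longrightarrow>
          (\<forall>x\<in>U. u_inf x = 0) \<or> (\<forall>x\<in>U. u_inf x = (p - 1) / p * \<mu>)) \<and>
       ((\<exists>U. admissible_set \<Omega> a u_inf U \<and> \<not> (\<forall>x\<in>U. u_inf x = 0)) \<longrightarrow> \<mu> > 0))"
proof -
  have lams_pos: "lams n > 0" for n using lams_seq(1)[of n] lam0_pos by simp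
  note limit = limit_of_minimizers_maximizes_J_fun[OF dom(1,4) a_star(1) p_gt lams_pos lams_seq(2)
      is_solution_in_Ka_set[OF sol[OF lams_seq(1)] lams_pos] mini[OF lams_seq(1)] lim]
  have K: "u_inf \<in> K_set \<Omega>" using limit(1) by (simp add: Ka_set_def)
  have p_pos: "p > 0" using p_gt by simp
  obtain v where v: "v \<in> K_set \<Omega>" "J_fun \<Omega> a p v > 0"
    using exists_K_set_J_fun_pos[OF dom(1,4) a_star(1) p_pos a_plus] by metis
  have "J_fun \<Omega> a p u_inf > 0" using limit(2)[OF v(1)] v(2) by linarith
  moreover have "J_fun \<Omega> a p w \<le> J_fun \<Omega> a p u_inf" if "w \<in> Ka_set \<Omega> a p" for w
    using limit(2)[of w] that by (simp add: Ka_set_def)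
  moreover have "u_inf x = 0" if "admissible_set \<Omega> a u_inf U" "x \<in> U" for U x
    using maximizer_vanishes_where_unconstrained[OF dom(1,4) a_star(1) p_gt K limit(2)] that
    unfolding admissible_set_def by blast
  \<comment> \<open>since the limit vanishes on every admissible set, every positive constant can serve as mu\<close>
  ultimately show ?thesis
    using limit(1) by (intro conjI exI[of _ "J_fun \<Omega> a p u_inf"] exI[of _ "1::real"]) auto
qed

end
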